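(* Suppose there exist a nonzero $u\in R(\mathbb{Z})_0^+$ and an open ball $B\subset\mathbb{R}^{\dim-1}$ such that for every $\gamma\in\mathcal{W}$ the sphere $\gamma.S_u$ is not contained in $B$. Then $E(\mathbb{Z})$ is an infinite-index subgroup of $G(\mathbb{Z})$.
   Context: Fix $\dim\in\{3,4,5\}$. If $\dim=3$, $R(\mathbb{Z})$ is the ring of integers of an imaginary quadratic field; if $\dim=4$, a maximal $\ddagger$-order of a rational definite quaternion algebra $\left(\frac{a,b}{\mathbb{Q}}\right)$ with orthogonal involution $(x+yi+zj+tij)^\ddagger=x+yi+zj-tij$; if $\dim=5$, a maximal order of a rational definite quaternion algebra. $R(\mathbb{Z})^+$ is the $\ddagger$-fixed subset if $\dim=4$ and $R(\mathbb{Z})$ otherwise; the subscript $0$ denotes the trace-zero elements ($\mathrm{tr}(\alpha)=\alpha+\bar\alpha$). $R(\mathbb{Z})^+\otimes\mathbb{R}$ is identified with Euclidean $\mathbb{R}^{\dim-1}$. $G(\mathbb{Z})=SL(2,R(\mathbb{Z}))$ if $\dim=3,5$ (for quaternions: determinant $1$ as $4\times4$ complex matrices via an embedding of the Hamilton quaternions into $\mathrm{Mat}(2,\mathbb{C})$), and $G(\mathbb{Z})=\{M:\hat\ddagger(M)M=M\hat\ddagger(M)=I\}$ if $\dim=4$, where $\hat\ddagger\begin{pmatrix}a&b\\c&d\end{pmatrix}=\begin{pmatrix}d^\ddagger&-b^\ddagger\\-c^\ddagger&a^\ddagger\end{pmatrix}$; $E(\mathbb{Z})$ is the subgroup generated by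 the upper and lower triangular matrices of $G(\mathbb{Z})$. $\mathcal{W}$ is the group generated by $W(\alpha)=\begin{pmatrix}\alpha&1\\-1&0\end{pmatrix}$, $\alpha\in R(\mathbb{Z})^+$, acting on $\mathbb{R}^{\dim-1}\cup\{\infty\}$ by $\rho\mapsto(a\rho+b)(c\rho+d)^{-1}$. $S_u$ is the hyperplane through $0$ with normal vector $u$. *)

theory Defs
  imports "HOL-Analysis.Analysis" "HOL-Algebra.Generated_Groups"
    "HOL-Computational_Algebra.Polynomial"
begin

section \<open>Hamilton quaternions\<close>

text \<open>\<open>Quat x y z t\<close> is $x + yi + zj + tk$ with $i^2 = j^2 = -1$, $ij = -ji = k$.\<close>

datatype quat = Quat (q1: real) (qi: real) (qj: real) (qk: real)

lemma quat_eq_iff: "x = y \<longleftrightarrow> q1 x = q1 y \<and> qi x = qi y \<and> qj x = qj y \<and> qk x = qk y"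
  by (cases x; cases y) auto

instantiation quat :: ring_1
begin

definition "0 = Quat 0 0 0 0"
definition "1 = Quat 1 0 0 0"
definition "- x = Quat (- q1 x) (- qi x) (- qj x) (- qk x)"
definition "x + y = Quat (q1 x + q1 y) (qi x + qi y) (qj x + qj y) (qk x + qk y)"
definition "x - y = Quat (q1 x - q1 y) (qi x - qi y) (qj x - qj y) (qk x - qk y)"
definition "x * y = Quat
  (q1 x * q1 y - qi x * qi y - qj x * qj y - qk x * qk y)
  (q1 x * qi y + qi x * q1 y + qj x * qk y - qk x * qj y)
  (q1 x * qj y - qi x * qk y + qj x * q1 y + qk x * qi y)
  (q1 x * qk y + qi x * qj y - qj x * qi y + qk x * q1 y)"

instance
  by standard
    (auto simp: zero_quat_def one_quat_def uminus_quat_def plus_quat_def minus_quat_def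
      times_quat_def algebra_simps)

end

instantiation quat :: real_algebra_1
begin

definition "r *\<^sub>R x = Quat (r * q1 x) (r * qi x) (r * qj x) (r * qk x)"

instance
  by standard
    (auto simp: scaleR_quat_def plus_quat_def times_quat_def quat_eq_iff algebra_simps)

end

lemma quat_sel [simp]:
  "q1 0 = 0" "qi 0 = 0" "qj 0 = 0" "qk 0 = 0"
  "q1 1 = 1" "qi 1 = 0" "qj 1 = 0" "qk 1 = 0"
  "q1 (- x) = - q1 x" "qi (- x) = - qi x" "qj (- x) = - qj x" "qk (- x) = - qk x"
  "q1 (x + y) = q1 x + q1 y" "qi (x + y) = qi x + qi y"
  "qj (x + y) = qj x + qj y" "qk (x + y) = qk x + qk y"
  "q1 (x - y) = q1 x - q1 y" "qi (x - y) = qi x - qi y"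
  "qj (x - y) = qj x - qj y" "qk (x - y) = qk x - qk y"
  "q1 (r *\<^sub>R x) = r * q1 x" "qi (r *\<^sub>R x) = r * qi x"
  "qj (r *\<^sub>R x) = r * qj x" "qk (r *\<^sub>R x) = r * qk x"
  by (auto simp: zero_quat_def one_quat_def uminus_quat_def plus_quat_def minus_quat_def
      scaleR_quat_def)

lemma quat_sel_times:
  "q1 (x * y) = q1 x * q1 y - qi x * qi y - qj x * qj y - qk x * qk y"
  "qi (x * y) = q1 x * qi y + qi x * q1 y + qj x * qk y - qk x * qj y"
  "qj (x * y) = q1 x * qj y - qi x * qk y + qj x * q1 y + qk x * qi y"
  "qk (x * y) = q1 x * qk y + qi x * qj y - qj x * qi y + qk x * q1 y"
  by (auto simp: times_quat_def)

definition qcnj :: "quat \<Rightarrow> quat" where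
  "qcnj x = Quat (q1 x) (- qi x) (- qj x) (- qk x)"

lemma qcnj_sel [simp]:
  "q1 (qcnj x) = q1 x" "qi (qcnj x) = - qi x" "qj (qcnj x) = - qj x" "qk (qcnj x) = - qk x"
  by (auto simp: qcnj_def)

instantiation quat :: real_inner
begin

definition "inner x y = q1 x * q1 y + qi x * qi y + qj x * qj y + qk x * (qk y :: real)"
definition "norm (x :: quat) = sqrt (inner x x)"
definition "sgn (x :: quat) = inverse (norm x) *\<^sub>R x"
definition "dist x y = norm (x - y :: quat)"
definition "(uniformity :: (quat \<times> quat) filter) = (INF e\<in>{0 <..}. principal {(x, y). dist x y < e})"
definition "open (U :: quat set) \<longleftrightarrow>
  (\<forall>x\<in>U. eventually (\<lambda>(x', y). x' = x \<longrightarrow> y \<in> U) uniformity)"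

instance
proof
  fix x y z :: quat and r :: real and U :: "quat set"
  show "sgn x = x /\<^sub>R norm x" by (simp add: sgn_quat_def)
  show "dist x y = norm (x - y)" by (simp add: dist_quat_def)
  show "(uniformity :: (quat \<times> quat) filter) = (INF e\<in>{0 <..}. principal {(x, y). dist x y < e})"
    by (simp add: uniformity_quat_def)
  show "open U \<longleftrightarrow> (\<forall>x\<in>U. eventually (\<lambda>(x', y). x' = x \<longrightarrow> y \<in> U) uniformity)"
    by (simp add: open_quat_def)
  show "inner x y = inner y x" by (simp add: inner_quat_def mult.commute)
  show "inner (x + y) z = inner x z + inner y z"
    by (simp add: inner_quat_def algebra_simps)
  show "inner (r *\<^sub>R x) y = r * inner x y"
    by (simp add: inner_quat_def algebra_simps)
  show "0 \<le> inner x x" by (simp add: inner_quat_def)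
  show "inner x x = 0 \<longleftrightarrow> x = 0"
    by (simp add: inner_quat_def quat_eq_iff add_nonneg_eq_0_iff)
  show "norm x = sqrt (inner x x)" by (simp add: norm_quat_def)
qed

end

lemma quat_times_qcnj: "x * qcnj x = inner x x *\<^sub>R 1" "qcnj x * x = inner x x *\<^sub>R 1"
  by (auto simp: quat_eq_iff quat_sel_times inner_quat_def algebra_simps)

instantiation quat :: division_ring
begin

definition inverse_quat :: "quat \<Rightarrow> quat" where
  "inverse_quat x = (1 / inner x x) *\<^sub>R qcnj x"
definition divide_quat :: "quat \<Rightarrow> quat \<Rightarrow> quat" where
  "divide_quat x y = x * inverse y"

instance
  by standard (simp_all add: inverse_quat_def divide_quat_def quat_times_qcnj)

end

instance quat :: real_normed_div_algebra
proof
  fix x y :: quat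
  have "inner (x * y) (x * y) = inner x x * inner y y"
    by (simp add: inner_quat_def quat_sel_times algebra_simps)
  then show "norm (x * y) = norm x * norm y"
    by (simp add: norm_quat_def real_sqrt_mult)
qed

instantiation quat :: euclidean_space
begin

definition "Basis = {Quat 1 0 0 0, Quat 0 1 0 0, Quat 0 0 1 0, Quat 0 0 0 1}"

instance
proof
  fix u v x :: quat
  show "(Basis :: quat set) \<noteq> {}" "finite (Basis :: quat set)"
    by (simp_all add: Basis_quat_def)
  show "u \<in> Basis \<Longrightarrow> v \<in> Basis \<Longrightarrow> inner u v = (if u = v then 1 else 0)"
    unfolding Basis_quat_def by (elim insertE emptyE) (simp_all add: inner_quat_def)
  show "(\<forall>u\<in>Basis. inner x u = 0) \<longleftrightarrow> x = 0"
    by (simp add: Basis_quat_def inner_quat_def quat_eq_iff[of x 0])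
qed

end


section \<open>The rings\<close>

definition imaginary_quadratic_field :: "complex set \<Rightarrow> bool" where
  "imaginary_quadratic_field K \<longleftrightarrow>
    (\<exists>d::nat. d > 0 \<and> K = {of_rat x + of_rat y * (\<i> * of_real (sqrt d)) |x y. True})"

definition ring_of_integers :: "complex set \<Rightarrow> complex set" where
  "ring_of_integers K = {z \<in> K. algebraic_int z}"

text \<open>
  For $a, b < 0$, the definite algebra $(a,b/\mathbb{Q})$ is realised as the rational span of
  $1, I, J, IJ$ inside the Hamilton quaternions, where $I = \sqrt{-a}\,i$ and $J = \sqrt{-b}\,j$.
  The Euclidean norm of the ambient space then restricts to the reduced norm form of the algebra, which
  is how $R(\mathbb{Z})^+\otimes\mathbb{R}$ becomes a Euclidean space.
\<close>

definition gen_I :: "rat \<Rightarrow> quat" where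
  "gen_I a = Quat 0 (sqrt (- of_rat a)) 0 0"

definition gen_J :: "rat \<Rightarrow> quat" where
  "gen_J b = Quat 0 0 (sqrt (- of_rat b)) 0"

definition quaternion_algebra :: "rat \<Rightarrow> rat \<Rightarrow> quat set" where
  "quaternion_algebra a b =
    {of_rat x *\<^sub>R 1 + of_rat y *\<^sub>R gen_I a + of_rat z *\<^sub>R gen_J b + of_rat t *\<^sub>R (gen_I a * gen_J b)
      |x y z t. True}"

lemma quaternion_algebra_relations:
  "a < 0 \<Longrightarrow> gen_I a * gen_I a = of_rat a *\<^sub>R 1"
  "b < 0 \<Longrightarrow> gen_J b * gen_J b = of_rat b *\<^sub>R 1"
  "gen_J b * gen_I a = - (gen_I a * gen_J b)"
proof -
  have *: "sqrt (- of_rat c) * sqrt (- of_rat c) = - of_rat c" if "c < 0" for c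
    using that by (intro real_sqrt_mult_self[THEN trans] abs_of_nonneg) simp
  show "a < 0 \<Longrightarrow> gen_I a * gen_I a = of_rat a *\<^sub>R 1"
    "b < 0 \<Longrightarrow> gen_J b * gen_J b = of_rat b *\<^sub>R 1"
    unfolding gen_I_def gen_J_def quat_eq_iff quat_sel_times quat.sel by (simp_all only: *) simp_all
  show "gen_J b * gen_I a = - (gen_I a * gen_J b)"
    by (simp add: gen_I_def gen_J_def quat_eq_iff quat_sel_times)
qed

definition qdag :: "quat \<Rightarrow> quat" where
  "qdag x = Quat (q1 x) (qi x) (qj x) (- qk x)"

text \<open>\<open>qdag\<close> is defined on all Hamilton quaternions; it restricts to the involution of the algebra:\<close>

lemma qdag_quaternion_algebra:
  "qdag (x *\<^sub>R 1 + y *\<^sub>R gen_I a + z *\<^sub>R gen_J b + t *\<^sub>R (gen_I a * gen_J b)) =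
    x *\<^sub>R 1 + y *\<^sub>R gen_I a + z *\<^sub>R gen_J b - t *\<^sub>R (gen_I a * gen_J b)"
  by (auto simp: qdag_def gen_I_def gen_J_def quat_eq_iff quat_sel_times)

lemma qdag_mult: "qdag (x * y) = qdag y * qdag x"
  by (auto simp: qdag_def quat_eq_iff quat_sel_times)

text \<open>An order is a subring which is a full \<open>\<int>\<close>-lattice.\<close>

definition is_order :: "quat set \<Rightarrow> quat set \<Rightarrow> bool" where
  "is_order A R \<longleftrightarrow>
    R \<subseteq> A \<and> 1 \<in> R \<and> (\<forall>x\<in>R. \<forall>y\<in>R. x - y \<in> R \<and> x * y \<in> R) \<and>
    (\<exists>S. finite S \<and> R = Modules.module.span (\<lambda>n::int. (*\<^sub>R) (of_int n)) S) \<and>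
    Modules.module.span (\<lambda>r::rat. (*\<^sub>R) (of_rat r)) R = A"

definition maximal_order :: "quat set \<Rightarrow> quat set \<Rightarrow> bool" where
  "maximal_order A R \<longleftrightarrow>
    is_order A R \<and> (\<forall>R'. is_order A R' \<and> R \<subseteq> R' \<longrightarrow> R' = R)"

definition dag_order :: "quat set \<Rightarrow> quat set \<Rightarrow> bool" where
  "dag_order A R \<longleftrightarrow> is_order A R \<and> qdag ` R = R"

text \<open>Maximal among the \<open>\<ddagger>\<close>-orders; such an order need not be a maximal order.\<close>

definition maximal_dag_order :: "quat set \<Rightarrow> quat set \<Rightarrow> bool" where
  "maximal_dag_order A R \<longleftrightarrow>
    dag_order A R \<and> (\<forall>R'. dag_order A R' \<and> R \<subseteq> R' \<longrightarrow> R' = R)"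

definition dag_fixed :: "quat set \<Rightarrow> quat set" where
  "dag_fixed R = {\<alpha> \<in> R. qdag \<alpha> = \<alpha>}"

definition trace_zero :: "('a::ring_1 \<Rightarrow> 'a) \<Rightarrow> 'a set \<Rightarrow> 'a set" where
  "trace_zero cj A = {\<alpha> \<in> A. \<alpha> + cj \<alpha> = 0}"


section \<open>The groups\<close>

definition mat2_over :: "'a set \<Rightarrow> ('a^2^2) set" where
  "mat2_over R = {M. \<forall>i j. M $ i $ j \<in> R}"

definition matrix_group :: "('a::ring_1^2^2) set \<Rightarrow> ('a^2^2) monoid" where
  "matrix_group X = \<lparr>carrier = X, mult = (**), one = mat 1\<rparr>"

definition SL2_complex :: "complex set \<Rightarrow> (complex^2^2) monoid" where
  "SL2_complex R = matrix_group {M \<in> mat2_over R. det M = 1}"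

text \<open>The embedding of the Hamilton quaternions into the complex \<open>2 \<times> 2\<close> matrices, and the \<open>4 \<times> 4\<close>
  matrix (with rows and columns indexed by pairs) whose blocks are the images of the entries.\<close>

definition quat_to_mat :: "quat \<Rightarrow> complex^2^2" where
  "quat_to_mat x = vector [vector [Complex (q1 x) (qi x), Complex (qj x) (qk x)],
                           vector [Complex (- qj x) (qk x), Complex (q1 x) (- qi x)]]"

lemma quat_to_mat_hom:
  "quat_to_mat 1 = mat 1"
  "quat_to_mat (x + y) = quat_to_mat x + quat_to_mat y"
  "quat_to_mat (x * y) = quat_to_mat x ** quat_to_mat y"
  by (simp_all only: quat_to_mat_def vec_eq_iff forall_2 matrix_matrix_mult_def sum_2 mat_def
      vector_2 vec_lambda_beta vector_add_component)
    (simp_all add: complex_eq_iff quat_sel_times algebra_simps)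

definition block_matrix :: "quat^2^2 \<Rightarrow> complex^(2 \<times> 2)^(2 \<times> 2)" where
  "block_matrix M = (\<chi> p q. quat_to_mat (M $ fst p $ fst q) $ snd p $ snd q)"

definition SL2_quat :: "quat set \<Rightarrow> (quat^2^2) monoid" where
  "SL2_quat R = matrix_group {M \<in> mat2_over R. det (block_matrix M) = 1}"

definition dag_hat :: "quat^2^2 \<Rightarrow> quat^2^2" where
  "dag_hat M = vector [vector [qdag (M $ 2 $ 2), - qdag (M $ 1 $ 2)],
                       vector [- qdag (M $ 2 $ 1), qdag (M $ 1 $ 1)]]"

definition SL2_dag :: "quat set \<Rightarrow> (quat^2^2) monoid" where
  "SL2_dag R =
    matrix_group {M \<in> mat2_over R. dag_hat M ** M = mat 1 \<and> M ** dag_hat M = mat 1}"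

definition elementary_subgroup :: "('a::ring_1^2^2) monoid \<Rightarrow> ('a^2^2) set" where
  "elementary_subgroup G = generate G {M \<in> carrier G. M $ 2 $ 1 = 0 \<or> M $ 1 $ 2 = 0}"

definition W_mat :: "'a::ring_1 \<Rightarrow> 'a^2^2" where
  "W_mat \<alpha> = vector [vector [\<alpha>, 1], vector [- 1, 0]]"

definition W_group :: "('a::ring_1^2^2) monoid \<Rightarrow> 'a set \<Rightarrow> ('a^2^2) set" where
  "W_group G P = generate G (W_mat ` P)"

definition infinite_index_subgroup :: "'a set \<Rightarrow> 'a monoid \<Rightarrow> bool" where
  "infinite_index_subgroup H G \<longleftrightarrow> subgroup H G \<and> infinite (rcosets\<^bsub>G\<^esub> H)"


section \<open>The action\<close>

text \<open>
  With \<open>P = R(\<int>)\<^sup>+\<close>, the space \<open>\<real>\<^bsup>dim-1\<^esup>\<close> is the real span of \<open>P\<close> with the ambient Euclidean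
  structure (all of \<open>\<complex>\<close>, respectively the quaternions with \<open>qk = 0\<close>, respectively all quaternions),
  and the point at infinity is \<open>None\<close>.
\<close>

fun moebius :: "'a::division_ring^2^2 \<Rightarrow> 'a option \<Rightarrow> 'a option" where
  "moebius M None =
    (if M $ 2 $ 1 = 0 then None else Some (M $ 1 $ 1 * inverse (M $ 2 $ 1)))"
| "moebius M (Some \<rho>) =
    (if M $ 2 $ 1 * \<rho> + M $ 2 $ 2 = 0 then None
     else Some ((M $ 1 $ 1 * \<rho> + M $ 1 $ 2) * inverse (M $ 2 $ 1 * \<rho> + M $ 2 $ 2)))"

text \<open>As a generalised sphere, a hyperplane contains the point at infinity.\<close>

definition S_plane :: "'a::real_inner set \<Rightarrow> 'a \<Rightarrow> 'a option set" where
  "S_plane P u = insert None (Some ` {\<rho> \<in> span P. inner \<rho> u = 0})"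

definition open_balls :: "'a::real_inner set \<Rightarrow> 'a set set" where
  "open_balls P = {ball c r \<inter> span P |c r. c \<in> span P \<and> r > 0}"

definition orbit_avoids_ball ::
  "('a::{division_ring,real_inner}^2^2) monoid \<Rightarrow> 'a set \<Rightarrow> 'a \<Rightarrow> 'a set \<Rightarrow> bool" where
  "orbit_avoids_ball G P u B \<longleftrightarrow>
    (\<forall>\<gamma>\<in>W_group G P. \<not> moebius \<gamma> ` S_plane P u \<subseteq> Some ` B)"

end

theory Submission
  imports Defs
begin

text \<open>
  Choose a point \<open>p = s / n\<close> of the ball with \<open>s \<in> R(\<int>)\<^sup>+\<close> and \<open>p\<close> off the hyperplane. The parabolic
  elements acting by \<open>1 / (\<rho> - p) \<mapsto> 1 / (\<rho> - p) - t\<close> lie in the group when \<open>t\<close> is a multiple of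
  \<open>n\<^sup>2\<close>, and for large \<open>t\<close> they contract the hyperplane into the ball. If the elementary subgroup had
  finite index, it would contain a power \<open>g\<close> of such an element. The elementary subgroup is the
  product of the group generated by the unipotent triangular matrices, which lies in \<open>\<W>\<close>, and the
  diagonal matrices, of which there are only finitely many because \<open>\<bar>x\<bar>\<^sup>2 \<in> \<int>\<close> for \<open>x \<in> R(\<int>)\<close>. Hence
  some power of \<open>g\<close> lies in \<open>\<W>\<close>, and its large powers contradict the hypothesis.
\<close>

section \<open>Powers in subgroups of finite index\<close>

text \<open>The point \<open>p\<close> has to avoid the hyperplane because the contraction rests on
  \<open>x - p\<close> being bounded away from 0 there: \<open>1 / (x - p)\<close> is then bounded,
  a large shift by \<open>t\<close> pushes it far out, and inverting again lands near
  \<open>p\<close>. The matrix involved is the conjugate of (1, 0; -t, 1) by the translation by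
  \<open>p\<close>. A real \<open>t\<close> is central, so the computation survives noncommuting
  entries; n^2 clears the denominators, since t p = n s and t p^2 = s^2.

  The obstacle is that triangular matrices with nontrivial diagonal are not visibly in \<W>, so a
  power of g inside the elementary subgroup is not yet a contradiction. Diagonal matrices can be
  moved past the unipotent group because they normalise it, and definiteness bounds them: a unit and
  its inverse both have a positive integer as squared norm.

  The three dimensions share one argument through a locale. In dimension 4 the set P need not be
  closed under products, which is why its stability under triangular and diagonal matrices is stated
  separately from the ring properties of R.\<close>

lemma (in group) finite_index_imp_pow_in:
  assumes H: "subgroup H G" and fin: "finite (rcosets H)" and g: "g \<in> carrier G"
  shows "\<exists>n::nat>0. g [^] n \<in> H"
proof -
  \<comment> \<open>\<open>H\<close> may fail to be normal, so the exponent comes from a coincidence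
    of two cosets of powers and not from the order of a quotient group.\<close>
  have "(\<lambda>n::nat. H #> g [^] n) ` UNIV \<subseteq> rcosets H"
    using g subgroup.subset[OF H] by (auto intro!: rcosetsI)
  then have "\<not> inj (\<lambda>n::nat. H #> g [^] n)"
    using fin finite_subset range_inj_infinite by blast
  then obtain k l :: nat where kl: "k < l" "H #> g [^] k = H #> g [^] l"
    unfolding inj_def by (metis nat_neq_iff)
  have "g [^] l \<in> H #> g [^] l"
    using rcos_self[OF _ H] g by simp
  then obtain h where h: "h \<in> H" "g [^] l = h \<otimes> g [^] k"
    unfolding kl(2)[symmetric] by (auto simp: r_coset_def simp del: nat_pow_mult)
  have hc: "h \<in> carrier G" using h(1) H subgroup.mem_carrier by fast
  have "g [^] (l - k) \<otimes> g [^] k = h \<otimes> g [^] k"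
    using kl(1) g h(2) by (simp add: nat_pow_mult)
  then have "g [^] (l - k) = h" using g hc by simp
  then show ?thesis using kl(1) h(1) by (intro exI[of _ "l - k"]) auto
qed

text \<open>Pigeonhole again, with \<open>D\<close> a mere finite set: two powers of
  \<open>g\<close> that share the factor from \<open>D\<close> have a quotient of the form
  \<open>w l \<otimes> inv (w k)\<close>, from which that factor has cancelled.\<close>

lemma (in group) pow_in_set_mult_finite:
  assumes W: "subgroup W G" and D: "finite D" "D \<subseteq> carrier G" and g: "g \<in> carrier G"
    and pow: "\<And>k::nat. g [^] k \<in> W <#> D"
  shows "\<exists>n::nat>0. g [^] n \<in> W"
proof -
  have "\<exists>w d. w \<in> W \<and> d \<in> D \<and> g [^] k = w \<otimes> d" for k :: nat
    using pow[of k] unfolding set_mult_def by auto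
  then obtain w d where wd: "\<And>k::nat. w k \<in> W" "\<And>k. d k \<in> D" "\<And>k. g [^] k = w k \<otimes> d k"
    by metis
  have "\<not> inj d"
    using D(1) wd(2) finite_subset[of "range d" D] range_inj_infinite by blast
  then obtain k l where kl: "k < l" "d k = d l"
    unfolding inj_def by (metis nat_neq_iff)
  have wc: "w i \<in> carrier G" for i using wd(1) W subgroup.mem_carrier by fast
  have dc: "d i \<in> carrier G" for i using wd(2) D by fast
  have "g [^] (l - k) \<otimes> (w k \<otimes> d k) = g [^] l"
    unfolding wd(3)[symmetric] using kl(1) g by (simp add: nat_pow_mult)
  also have "\<dots> = w l \<otimes> d k" using wd(3) kl by simp
  finally have "g [^] (l - k) \<otimes> w k = w l"
    using g wc dc by (simp flip: m_assoc)
  then have "g [^] (l - k) = w l \<otimes> inv (w k)"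
    using g wc by (simp add: inv_solve_right)
  then have "g [^] (l - k) \<in> W"
    using wd(1) W by (simp add: subgroup.m_closed subgroup.m_inv_closed)
  then show ?thesis using kl(1) by (intro exI[of _ "l - k"]) auto
qed

section \<open>Two by two matrices\<close>

lemma matrix_group_simps [simp]:
  "carrier (matrix_group X) = X" "M \<otimes>\<^bsub>matrix_group X\<^esub> N = M ** N"
  "\<one>\<^bsub>matrix_group X\<^esub> = mat 1"
  by (simp_all add: matrix_group_def)

lemma group_matrix_groupI:
  assumes "mat 1 \<in> X" "\<And>M N. M \<in> X \<Longrightarrow> N \<in> X \<Longrightarrow> M ** N \<in> X"
    and "\<And>M. M \<in> X \<Longrightarrow> \<exists>N\<in>X. N ** M = mat 1"
  shows "group (matrix_group X)"
  by (rule groupI) (use assms in \<open>auto simp: matrix_mul_assoc\<close>)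

definition mat2 :: "'a \<Rightarrow> 'a \<Rightarrow> 'a \<Rightarrow> 'a \<Rightarrow> 'a::zero^2^2" where
  "mat2 a b c d = vector [vector [a, b], vector [c, d]]"

lemma mat2_sel [simp]:
  "mat2 a b c d $ 1 $ 1 = a" "mat2 a b c d $ 1 $ 2 = b"
  "mat2 a b c d $ 2 $ 1 = c" "mat2 a b c d $ 2 $ 2 = d"
  by (simp_all add: mat2_def)

lemma mat2_eqI:
  assumes "M $ 1 $ 1 = a" "M $ 1 $ 2 = b" "M $ 2 $ 1 = c" "M $ 2 $ 2 = d"
  shows "M = mat2 a b c d"
  using assms by (simp add: vec_eq_iff forall_2)

lemma mat2_eq_iff [simp]:
  "mat2 a b c d = mat2 a' b' c' d' \<longleftrightarrow> a = a' \<and> b = b' \<and> c = c' \<and> d = d'"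
  by (metis mat2_sel)

lemma mat2_cases:
  obtains a b c d where "M = mat2 a b c d"
  using mat2_eqI by blast

lemma mat2_mult: "mat2 a b c d ** mat2 a' b' c' d' =
    mat2 (a * a' + b * c') (a * b' + b * d') (c * a' + d * c') (c * b' + d * (d'::'a::semiring_1))"
  by (rule mat2_eqI) (simp_all add: matrix_matrix_mult_def sum_2)

lemma mat_1_mat2: "mat 1 = mat2 1 0 0 (1::'a::semiring_1)"
  by (rule mat2_eqI) (simp_all add: mat_def)

lemma mat2_in_mat2_over [simp]: 
  "mat2 a b c d \<in> mat2_over R \<longleftrightarrow> a \<in> R \<and> b \<in> R \<and> c \<in> R \<and> d \<in> R"
  by (auto simp: mat2_over_def forall_2)

lemma W_mat_mat2: "W_mat \<alpha> = mat2 \<alpha> 1 (- 1) 0"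
  by (simp add: W_mat_def mat2_def)

lemma dag_hat_mat2 [simp]: "dag_hat (mat2 a b c d) = mat2 (qdag d) (- qdag b) (- qdag c) (qdag a)"
  by (simp add: dag_hat_def mat2_sel) (simp add: mat2_def)

section \<open>Integrality and density for lattices\<close>

text \<open>In lowest terms r = p / q, every q^k divides \<open>m\<close>. The choice k = m already
  excludes q \<ge> 2, because 2^m > m.\<close>

lemma rat_in_Ints_if_powers_bounded:
  fixes r :: real
  assumes r: "r \<in> \<rat>" and m: "m > (0::nat)" and pow: "\<And>k::nat. of_nat m * r ^ k \<in> \<int>"
  shows "r \<in> \<int>"
proof -
  obtain p q :: int where pq: "q > 0" "coprime p q" "r = of_int p / of_int q"
    using r by (elim Rats_cases') auto
  have dvd: "q ^ k dvd int m" for k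
  proof -
    obtain z where "of_nat m * r ^ k = of_int z" using pow[of k] by (elim Ints_cases)
    then have "real_of_int (int m * p ^ k) = of_int (z * q ^ k)"
      using pq(1) by (simp add: pq(3) power_divide field_simps)
    then have "int m * p ^ k = z * q ^ k" by (simp only: of_int_eq_iff)
    then have "q ^ k dvd int m * p ^ k" by simp
    moreover have "coprime (q ^ k) (p ^ k)" using pq(2) by (simp add: coprime_commute)
    ultimately show ?thesis by (simp add: coprime_dvd_mult_left_iff)
  qed
  have "q = 1"
  proof (rule ccontr)
    assume "q \<noteq> 1"
    then have q2: "q \<ge> 2" using pq(1) by simp
    have "int m < 2 ^ m" by (metis of_nat_less_two_power)
    also have "\<dots> \<le> q ^ m" using q2 by (intro power_mono) auto
    also have "\<dots> \<le> int m" using dvd[of m] m by (intro zdvd_imp_le) auto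
    finally show False by simp
  qed
  then show ?thesis using pq(3) by simp
qed

abbreviation int_span :: "'a::real_vector set \<Rightarrow> 'a set" where
  "int_span \<equiv> Modules.module.span (\<lambda>n::int. (*\<^sub>R) (of_int n))"

lemma int_module: "Modules.module (\<lambda>n::int. (*\<^sub>R) (of_int n) :: 'a::real_vector \<Rightarrow> 'a)"
  by unfold_locales (simp_all add: algebra_simps)

lemmas int_span_base = Modules.module.span_base[OF int_module]
  and int_span_zero = Modules.module.span_zero[OF int_module]
  and int_span_add = Modules.module.span_add[OF int_module]
  and int_span_neg = Modules.module.span_neg[OF int_module]
  and int_span_sum = Modules.module.span_sum[OF int_module]
  and int_span_scale = Modules.module.span_scale[OF int_module]

lemmas int_span_induct [consumes 1, case_names base step] =
  Modules.module.span_induct_alt[OF int_module]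

text \<open>A common denominator of the finitely many inner products of generators serves the whole
  lattice by bilinearity.\<close>

lemma int_span_inner_bounded_denominators:
  fixes S :: "'a::real_inner set"
  assumes fin: "finite S" and rat: "\<And>s t. s \<in> S \<Longrightarrow> t \<in> S \<Longrightarrow> inner s t \<in> \<rat>"
  shows "\<exists>m::nat>0. \<forall>x\<in>int_span S. \<forall>y\<in>int_span S. of_nat m * inner x y \<in> \<int>"
proof -
  have "\<exists>m::nat>0. \<forall>r\<in>Q. of_nat m * r \<in> \<int>" if "finite Q" "Q \<subseteq> \<rat>" for Q :: "real set"
    using that
  proof (induction Q)
    case (insert r Q)
    then obtain m :: nat where m: "m > 0" "\<forall>r\<in>Q. of_nat m * r \<in> \<int>" by auto
    have "r \<in> \<rat>" using insert.prems by simp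
    then obtain p q :: int where pq: "q > 0" "r = of_int p / of_int q"
      by (elim Rats_cases') auto
    have "of_nat (nat q * m) * r = of_int (int m * p)" using pq by (simp add: field_simps)
    moreover have "of_nat (nat q * m) * s = of_int q * (of_nat m * s)" for s :: real
      using pq(1) by simp
    ultimately show ?case using m pq(1)
      by (intro exI[of _ "nat q * m"]) (metis Ints_mult Ints_of_int insert_iff mult_pos_pos zero_less_nat_eq)
  qed auto
  from this[of "(\<lambda>(s, t). inner s t) ` (S \<times> S)"] obtain m :: nat where
    m: "m > 0" "\<And>s t. s \<in> S \<Longrightarrow> t \<in> S \<Longrightarrow> of_nat m * inner s t \<in> \<int>"
    using fin rat by force
  have 1: "of_nat m * inner x t \<in> \<int>" if "x \<in> int_span S" "t \<in> S" for x t
    using that(1)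
  proof (induction rule: int_span_induct)
    case (step c s y)
    have "of_nat m * inner (of_int c *\<^sub>R s + y) t = of_int c * (of_nat m * inner s t) + of_nat m * inner y t"
      by (simp add: inner_add_left algebra_simps)
    then show ?case using step m(2)[OF step.hyps(1) that(2)] by simp
  qed simp
  have "of_nat m * inner x y \<in> \<int>" if x: "x \<in> int_span S" and y: "y \<in> int_span S" for x y
    using y
  proof (induction rule: int_span_induct)
    case (step c s y)
    have "of_nat m * inner x (of_int c *\<^sub>R s + y) = of_int c * (of_nat m * inner x s) + of_nat m * inner x y"
      by (simp add: inner_add_right algebra_simps)
    then show ?case using step 1[OF x step.hyps(1)] by simp
  qed simp
  then show ?thesis using m(1) by blast
qed

text \<open>Multiplication by \<open>x\<close> preserves a lattice containing 1, so all powers of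
  \<open>x\<close> lie in it. Their squared norms are the powers of \<open>(norm x)\<^sup>2\<close>
  and have a common denominator, which only an integer allows. This serves both quaternion orders
  and the lattice Z[z] of an algebraic integer z.\<close>

lemma norm_square_integral:
  fixes S :: "'a::{real_normed_div_algebra,real_inner} set"
  assumes fin: "finite S" and rat: "\<And>s t. s \<in> S \<Longrightarrow> t \<in> S \<Longrightarrow> inner s t \<in> \<rat>"
    and one: "1 \<in> int_span S" and x: "\<And>y. y \<in> int_span S \<Longrightarrow> x * y \<in> int_span S"
  shows "(norm x)\<^sup>2 \<in> \<int>"
proof -
  obtain m :: nat where m: "m > 0"
    "\<And>x y. x \<in> int_span S \<Longrightarrow> y \<in> int_span S \<Longrightarrow> of_nat m * inner x y \<in> \<int>"
    using int_span_inner_bounded_denominators[OF fin rat] by blast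
  have pow: "x ^ k \<in> int_span S" for k by (induction k) (use one x in auto)
  have eq: "of_nat m * inner (x ^ k) (x ^ k) = of_nat m * ((norm x)\<^sup>2) ^ k" for k
    by (simp add: norm_power flip: power2_norm_eq_inner) (simp add: power_mult[symmetric] mult.commute)
  have "of_nat m * (norm x)\<^sup>2 \<in> \<int>" using m(2)[OF pow[of 1] pow[of 1]] unfolding eq by simp
  then have "of_nat m * (norm x)\<^sup>2 / of_nat m \<in> \<rat>" using Ints_subset_Rats by (intro Rats_divide) auto
  then have "(norm x)\<^sup>2 \<in> \<rat>" using m(1) by simp
  then show ?thesis
  proof (rule rat_in_Ints_if_powers_bounded[OF _ m(1)])
    show "of_nat m * ((norm x)\<^sup>2) ^ k \<in> \<int>" for k
      using m(2)[OF pow[of k] pow[of k]] unfolding eq .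
  qed
qed

text \<open>Differences have integral squared norm, so distinct elements are at distance at least 1.
  A limit point in the compact unit ball would give two distinct elements closer than that.\<close>

lemma finite_unit_ball_if_norm_square_integral:
  fixes R :: "'a::euclidean_space set"
  assumes diff: "\<And>x y. x \<in> R \<Longrightarrow> y \<in> R \<Longrightarrow> x - y \<in> R"
    and int: "\<And>x. x \<in> R \<Longrightarrow> (norm x)\<^sup>2 \<in> \<int>"
  shows "finite {x \<in> R. norm x \<le> 1}"
proof -
  let ?F = "{x \<in> R. norm x \<le> 1}"
  have sep: "x = y" if xy: "x \<in> R" "y \<in> R" "dist y x < 1" for x y
  proof -
    obtain n where n: "(norm (y - x))\<^sup>2 = of_int n"
      using int[OF diff[OF xy(2,1)]] by (elim Ints_cases)
    have "(norm (y - x))\<^sup>2 < 1"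
      using xy(3) by (simp add: dist_norm power_less_one_iff)
    then have "n = 0" using n zero_le_power2[of "norm (y - x)"] by simp
    then show ?thesis using n by simp
  qed
  have "\<not> z islimpt ?F" for z
  proof
    assume "z islimpt ?F"
    then have lim: "\<exists>x\<in>?F. x \<noteq> z \<and> dist x z < e" if "e > 0" for e
      using that unfolding islimpt_approachable by blast
    obtain x where x: "x \<in> ?F" "x \<noteq> z" "dist x z < 1 / 2"
      using lim[of "1 / 2"] by auto
    obtain y where y: "y \<in> ?F" "dist y z < min (1 / 2) (dist x z)"
      using lim[of "min (1 / 2) (dist x z)"] x(2) by auto
    have "dist y x < 1" using dist_triangle2[of y x z] x(3) y(2) by linarith
    then show False using sep[of x y] x y by auto
  qed
  then have "finite (cball 0 1 \<inter> ?F)"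
    by (intro finite_not_islimpt_in_compact) auto
  moreover have "cball 0 1 \<inter> ?F = ?F" by auto
  ultimately show ?thesis by simp
qed

section \<open>Density of the rational multiples of lattice points\<close>

lemma rational_points_dense:
  fixes P :: "'a::euclidean_space set"
  assumes diff: "\<And>x y. x \<in> P \<Longrightarrow> y \<in> P \<Longrightarrow> x - y \<in> P" and ne: "P \<noteq> {}"
    and x: "x \<in> span P" and e: "e > 0"
  obtains s and n :: nat where "s \<in> P" "n > 0" "dist (s /\<^sub>R of_nat n) x < e"
proof -
  have zero: "0 \<in> P" using ne diff by (metis all_not_in_conv diff_self)
  have neg: "- x \<in> P" if "x \<in> P" for x using diff[OF zero that] by simp
  have add: "x + y \<in> P" if "x \<in> P" "y \<in> P" for x y
    using diff[OF that(1) neg[OF that(2)]] by simp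
  have nat: "of_nat n *\<^sub>R x \<in> P" if "x \<in> P" for x and n :: nat
    using that by (induction n) (auto simp: zero add algebra_simps)
  have int: "of_int k *\<^sub>R x \<in> P" if "x \<in> P" for x and k :: int
    by (cases k) (use nat neg that in \<open>auto simp del: of_nat_Suc\<close>)
  have "\<forall>e>0. \<exists>s\<in>P. \<exists>n::nat>0. dist (s /\<^sub>R of_nat n) x < e"
    using x
  proof (induction rule: span_induct_alt)
    case base
    then show ?case using zero by (intro allI impI bexI[of _ 0] exI[of _ 1]) auto
  next
    case (step c a y)
    show ?case
    proof (intro allI impI)
      fix e :: real assume e: "e > 0"
      obtain s and n :: nat where s: "s \<in> P" "n > 0" "dist (s /\<^sub>R of_nat n) y < e / 2"
        using step.IH e by (meson half_gt_zero)
      have a: "norm a + 1 > 0" by (simp add: add_nonneg_pos)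
      define h where "h = e / 2"
      \<comment> \<open>The \<open>+ 1\<close> keeps \<open>d\<close> positive when
        \<open>a = 0\<close>. Replacing \<open>c\<close> by a rational within \<open>d\<close> moves
        \<open>c *\<^sub>R a\<close> by at most \<open>h\<close>, half of the allowed error.\<close>
      define d where "d = h / (norm a + 1)"
      have d: "d > 0" using e a by (simp add: d_def h_def)
      obtain q where q: "q \<in> \<rat>" "c - d < q" "q < c" using Rats_dense_in_real[of "c - d" c] d by auto
      then obtain k l :: int where kl: "l > 0" "q = of_int k / of_int l" by (elim Rats_cases') auto
      define m where "m = nat l"
      have m: "m > 0" "q = of_int k / of_nat m" using kl by (auto simp: m_def)
      define s' where "s' = of_nat n *\<^sub>R (of_int k *\<^sub>R a) + of_nat m *\<^sub>R s"
      have s'P: "s' \<in> P" unfolding s'_def by (intro add nat int s(1) step.hyps)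
      have eq: "s' /\<^sub>R of_nat (m * n) = q *\<^sub>R a + s /\<^sub>R of_nat n"
        using m s(2) by (simp add: s'_def scaleR_add_right field_simps)
      have "dist (q *\<^sub>R a) (c *\<^sub>R a) = \<bar>q - c\<bar> * norm a"
        by (simp add: dist_norm flip: scaleR_diff_left)
      also have "\<dots> \<le> d * (norm a + 1)" using q d by (intro mult_mono) auto
      also have "\<dots> = h" using a by (simp add: d_def)
      finally have "dist (q *\<^sub>R a + s /\<^sub>R of_nat n) (c *\<^sub>R a + y) < e"
        using s(3) dist_triangle_add[of "q *\<^sub>R a" "s /\<^sub>R of_nat n" "c *\<^sub>R a" y] unfolding h_def by linarith
      then show "\<exists>s\<in>P. \<exists>n::nat>0. dist (s /\<^sub>R of_nat n) (c *\<^sub>R a + y) < e"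
        using s'P m(1) s(2) unfolding eq[symmetric] by (intro bexI[of _ s'] exI[of _ "m * n"]) auto
    qed
  qed
  then show ?thesis using e that by blast
qed

lemma rational_point_off_hyperplane:
  fixes P :: "'a::euclidean_space set"
  assumes diff: "\<And>x y. x \<in> P \<Longrightarrow> y \<in> P \<Longrightarrow> x - y \<in> P"
    and u: "u \<in> P" "u \<noteq> 0" and c: "c \<in> span P" and r: "r > 0"
  obtains s and n :: nat where "s \<in> P" "n > 0"
    "s /\<^sub>R of_nat n \<in> ball c r" "inner (s /\<^sub>R of_nat n) u \<noteq> 0"
proof -
  define d where "d = r / (2 * norm u)"
  have d: "d > 0" "d * norm u < r" using r u by (simp_all add: d_def)
  \<comment> \<open>A centre on the hyperplane is moved off it along \<open>u\<close>, by a vector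
    of length r / 2, so it stays in the ball.\<close>
  define c' where "c' = (if inner c u = 0 then c + d *\<^sub>R u else c)"
  have c': "c' \<in> span P" "c' \<in> ball c r" "inner c' u \<noteq> 0"
    using c u d r by (auto simp: c'_def span_add span_scale span_base inner_add_left dist_norm)
  have "open (ball c r \<inter> {x. inner x u \<noteq> 0})"
    by (intro open_Int open_ball open_Collect_neq continuous_intros)
  then obtain e where e: "e > 0" "ball c' e \<subseteq> ball c r \<inter> {x. inner x u \<noteq> 0}"
    using c' unfolding open_contains_ball by blast
  obtain s and n :: nat where s: "s \<in> P" "n > 0" "dist (s /\<^sub>R of_nat n) c' < e"
    using rational_points_dense[OF diff _ c'(1) e(1)] u by blast
  then have "s /\<^sub>R of_nat n \<in> ball c r \<inter> {x. inner x u \<noteq> 0}"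
    using e(2) by (auto simp: dist_commute)
  then show ?thesis using that s by blast
qed

section \<open>Parabolic elements\<close>

text \<open>\<open>parab p t\<close> fixes \<open>p\<close> and acts by \<open>1 / (x - p) \<mapsto> 1 / (x - p) - t\<close>.\<close>

definition parab :: "'a::real_algebra_1 \<Rightarrow> real \<Rightarrow> 'a^2^2" where
  "parab p t = mat2 (1 - t *\<^sub>R p) (t *\<^sub>R (p * p)) (- (t *\<^sub>R 1)) (1 + t *\<^sub>R p)"

lemma parab_0: "parab p 0 = mat 1"
  by (simp add: parab_def mat_1_mat2)

lemma parab_add: "parab p s ** parab p t = parab p (s + t)"
  by (simp add: parab_def mat2_mult algebra_simps)

lemma parab_pow: "parab p t [^]\<^bsub>matrix_group X\<^esub> (n::nat) = parab p (of_nat n * t)"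
  by (induction n) (simp_all add: parab_0 parab_add algebra_simps)

lemma moebius_parab_None:
  fixes p :: "'a::{real_normed_div_algebra}"
  assumes "t \<noteq> 0"
  shows "moebius (parab p t) None = Some (p - (1 / t) *\<^sub>R 1)"
proof -
  have "inverse (- (t *\<^sub>R (1::'a))) = - ((1 / t) *\<^sub>R 1)"
    using assms by (intro inverse_unique) simp
  then show ?thesis using assms by (simp add: parab_def algebra_simps)
qed

text \<open>With z = x - p the denominator is 1 - t z = (1/z - t) z, and the numerator is p times
  this denominator plus z. Dividing on the right leaves p + 1/(1/z - t), without commuting p and
  z.\<close>

lemma moebius_parab_Some:
  fixes p :: "'a::{real_normed_div_algebra}"
  assumes z: "x \<noteq> p" and t: "inverse (x - p) \<noteq> t *\<^sub>R 1"
  shows "moebius (parab p t) (Some x) = Some (p + inverse (inverse (x - p) - t *\<^sub>R 1))"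
proof -
  define z where "z = x - p"
  have x: "x = p + z" and z0: "z \<noteq> 0" using z by (simp_all add: z_def)
  have den: "(- (t *\<^sub>R 1)) * x + (1 + t *\<^sub>R p) = (inverse z - t *\<^sub>R 1) * z"
    using z0 by (simp add: x algebra_simps)
  have num: "(1 - t *\<^sub>R p) * x + t *\<^sub>R (p * p) = p * ((inverse z - t *\<^sub>R 1) * z) + z"
    using z0 by (simp add: x algebra_simps)
  have nz: "inverse z - t *\<^sub>R 1 \<noteq> 0" using t by (simp add: z_def)
  have "z * inverse ((inverse z - t *\<^sub>R 1) * z) = inverse (inverse z - t *\<^sub>R 1)"
    using nz z0 by (simp add: nonzero_inverse_mult_distrib flip: mult.assoc)
  then have "(p * ((inverse z - t *\<^sub>R 1) * z) + z) * inverse ((inverse z - t *\<^sub>R 1) * z)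
      = p + inverse (inverse z - t *\<^sub>R 1)"
    using nz z0 by (simp add: distrib_right mult.assoc)
  then show ?thesis
    using nz z0 unfolding z_def[symmetric] parab_def moebius.simps mat2_sel den num by simp
qed

text \<open>The image must also stay in the Euclidean space \<open>span P\<close>, which in
  dimension 4 is a proper subspace of the quaternions; closure of the span under inverses ensures
  this.\<close>

lemma parab_contracts_hyperplane:
  fixes P :: "'a::{real_normed_div_algebra,euclidean_space} set"
  assumes p: "p \<in> span P" "p \<in> ball c r" "inner p u \<noteq> 0" and one: "1 \<in> P"
    and inv: "\<And>x. x \<in> span P \<Longrightarrow> inverse x \<in> span P"
  obtains T where "\<And>t. t > T \<Longrightarrow> moebius (parab p t) ` S_plane P u \<subseteq> Some ` (ball c r \<inter> span P)"
proof -
  define e where "e = r - dist c p"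
  have e: "e > 0" using p(2) by (simp add: e_def)
  have near: "p + y \<in> ball c r" if "norm y < e" for y
    using that dist_triangle[of c "p + y" p] by (simp add: e_def dist_norm)
  have u: "u \<noteq> 0" using p(3) by auto
  define d where "d = \<bar>inner p u\<bar> / norm u"
  have d: "d > 0" using p(3) u by (simp add: d_def)
  have span1: "t *\<^sub>R 1 \<in> span P" for t using one by (simp add: span_scale span_base)
  \<comment> \<open>Here \<open>d\<close> is the distance from \<open>p\<close> to the hyperplane,
    and the ball of radius \<open>e\<close> about \<open>p\<close> lies in the given one. Since 1/(x
    - p) has norm at most 1/d, the threshold makes the shifted vector longer than 1/e. It also gives
    1/t < e, which handles the image p - 1/t of infinity.\<close>
  show ?thesis
  proof (rule that[of "1 / d + 1 / e"], rule image_subsetI)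
    fix t :: real and q assume t: "t > 1 / d + 1 / e" and q: "q \<in> S_plane P u"
    have pos: "1 / d > 0" "1 / e > 0" using d e by auto
    show "moebius (parab p t) q \<in> Some ` (ball c r \<inter> span P)"
    proof (cases q)
      case None
      have "t > 0" using t pos by linarith
      have "1 / t < e" using t pos e by (smt (verit) divide_less_eq mult.commute nonzero_eq_divide_eq)
      then have "norm (- ((1 / t) *\<^sub>R (1::'a))) < e" using \<open>t > 0\<close> by simp
      then have "p - (1 / t) *\<^sub>R 1 \<in> ball c r" using near by fastforce
      then show ?thesis using p(1) span1 None moebius_parab_None[of t p] \<open>t > 0\<close>
        by (simp add: span_diff del: moebius.simps)
    next
      case (Some x)
      then have x: "x \<in> span P" "inner x u = 0" using q by (auto simp: S_plane_def)
      have "\<bar>inner p u\<bar> = \<bar>inner (x - p) u\<bar>" using x(2) by (simp add: inner_diff_left)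
      also have "\<dots> \<le> norm (x - p) * norm u" by (rule Cauchy_Schwarz_ineq2)
      finally have dn: "d \<le> norm (x - p)" using u by (simp add: d_def field_simps)
      then have xp: "x \<noteq> p" using d by auto
      have "norm (inverse (x - p)) \<le> 1 / d"
        using le_imp_inverse_le[OF dn d] unfolding norm_inverse by (simp add: divide_inverse)
      then have big: "norm (inverse (x - p) - t *\<^sub>R 1) > 1 / e"
        using t pos norm_triangle_ineq3[of "inverse (x - p)" "t *\<^sub>R 1"] by simp
      then have ne: "inverse (x - p) \<noteq> t *\<^sub>R 1" using pos by auto
      have "norm (inverse (inverse (x - p) - t *\<^sub>R 1)) < e"
        using less_imp_inverse_less[OF big pos(2)] by (simp add: norm_inverse)
      then show ?thesis
        using near p(1) x(1) span1 Some inv moebius_parab_Some[OF xp ne]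
        by (simp add: span_add span_diff del: moebius.simps)
    qed
  qed
qed

section \<open>The elementary subgroup\<close>

text \<open>A zero off the diagonal leaves a one-sided identity for each diagonal entry, one from
  \<open>N ** M\<close> and one from \<open>M ** N\<close>; in a division ring one side is enough.
  If both matrices have entries in a ring, the diagonal entries are therefore units of that
  ring.\<close>

lemma triangular_unit_entries:
  fixes M N :: "'a::division_ring^2^2"
  assumes NM: "N ** M = mat 1" and MN: "M ** N = mat 1"
  shows "M $ 2 $ 1 = 0 \<Longrightarrow> M $ 1 $ 1 \<noteq> 0 \<and> M $ 2 $ 2 \<noteq> 0 \<and> N $ 2 $ 1 = 0 \<and>
      N $ 1 $ 1 = inverse (M $ 1 $ 1) \<and> N $ 2 $ 2 = inverse (M $ 2 $ 2)"
    and "M $ 1 $ 2 = 0 \<Longrightarrow> M $ 1 $ 1 \<noteq> 0 \<and> M $ 2 $ 2 \<noteq> 0 \<and> N $ 1 $ 2 = 0 \<and>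
      N $ 1 $ 1 = inverse (M $ 1 $ 1) \<and> N $ 2 $ 2 = inverse (M $ 2 $ 2)"
proof -
  obtain a b c d where M: "M = mat2 a b c d" by (rule mat2_cases)
  obtain a' b' c' d' where N: "N = mat2 a' b' c' d'" by (rule mat2_cases)
  have eqs: "a' * a + b' * c = 1" "a' * b + b' * d = 0" "c' * a + d' * c = 0" "c' * b + d' * d = 1"
    "a * a' + b * c' = 1" "a * b' + b * d' = 0" "c * a' + d * c' = 0" "c * b' + d * d' = 1"
    using NM MN by (simp_all add: M N mat2_mult mat_1_mat2)
  have unit: "x \<noteq> 0 \<and> y = inverse x" if "x * y = 1" for x y :: 'a
    using that inverse_unique by fastforce
  have unit': "x \<noteq> 0 \<and> y = inverse x" if "y * x = 1" for x y :: 'a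
    using that unit[OF that] by (metis inverse_inverse_eq nonzero_imp_inverse_nonzero)
  show "M $ 1 $ 1 \<noteq> 0 \<and> M $ 2 $ 2 \<noteq> 0 \<and> N $ 2 $ 1 = 0 \<and>
      N $ 1 $ 1 = inverse (M $ 1 $ 1) \<and> N $ 2 $ 2 = inverse (M $ 2 $ 2)" if "M $ 2 $ 1 = 0"
    using that unit'[of a' a] unit[of d d'] eqs by (auto simp: M N)
  show "M $ 1 $ 1 \<noteq> 0 \<and> M $ 2 $ 2 \<noteq> 0 \<and> N $ 1 $ 2 = 0 \<and>
      N $ 1 $ 1 = inverse (M $ 1 $ 1) \<and> N $ 2 $ 2 = inverse (M $ 2 $ 2)" if "M $ 1 $ 2 = 0"
    using that unit[of a a'] unit'[of d' d] eqs by (auto simp: M N)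
qed

lemma parab_integral_entries:
  assumes "n > (0::nat)"
  shows "parab (s /\<^sub>R of_nat n) ((of_nat n)\<^sup>2) =
    mat2 (1 - of_nat n * s) (s * s) (- of_nat (n\<^sup>2)) (1 + of_nat n * s)"
  using assms
  by (simp add: parab_def power2_eq_square field_simps) (simp add: scaleR_conv_of_real)

text \<open>\<open>X\<close>, \<open>R\<close> and \<open>P\<close> play the roles of \<open>G(\<int>)\<close>, \<open>R(\<int>)\<close> and \<open>R(\<int>)\<^sup>+\<close>.\<close>

locale elementary_setting =
  fixes X :: "('a::{real_normed_div_algebra,euclidean_space}^2^2) set" and R P :: "'a set"
  assumes group_X: "group (matrix_group X)"
    and X_entries: "X \<subseteq> mat2_over R"
    and R_diff: "x \<in> R \<Longrightarrow> y \<in> R \<Longrightarrow> x - y \<in> R"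
    and R_norm: "x \<in> R \<Longrightarrow> (norm x)\<^sup>2 \<in> \<int>"
    and P_diff: "x \<in> P \<Longrightarrow> y \<in> P \<Longrightarrow> x - y \<in> P"
    and P_one: "1 \<in> P"
    and P_span_inverse: "x \<in> span P \<Longrightarrow> inverse x \<in> span P"
    and W_in: "\<alpha> \<in> P \<Longrightarrow> W_mat \<alpha> \<in> X"
    and parab_in: "s \<in> P \<Longrightarrow> n > 0 \<Longrightarrow> parab (s /\<^sub>R of_nat n) ((of_nat n)\<^sup>2) \<in> X"
    and upper_in: "M \<in> X \<Longrightarrow> M $ 2 $ 1 = 0 \<Longrightarrow> M $ 1 $ 2 * inverse (M $ 2 $ 2) \<in> P"
    and lower_in: "M \<in> X \<Longrightarrow> M $ 1 $ 2 = 0 \<Longrightarrow> M $ 2 $ 1 * inverse (M $ 1 $ 1) \<in> P"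
    and diag_in: "M \<in> X \<Longrightarrow> M $ 1 $ 2 = 0 \<Longrightarrow> M $ 2 $ 1 = 0 \<Longrightarrow> \<alpha> \<in> P \<Longrightarrow>
      M $ 1 $ 1 * \<alpha> * inverse (M $ 2 $ 2) \<in> P \<and> M $ 2 $ 2 * \<alpha> * inverse (M $ 1 $ 1) \<in> P"
begin

abbreviation "G \<equiv> matrix_group X"

sublocale group "matrix_group X"
  rewrites "carrier G = X" and "\<And>M N. M \<otimes>\<^bsub>G\<^esub> N = M ** N" and "\<one>\<^bsub>G\<^esub> = mat 1"
  using group_X by simp_all

abbreviation U where "U \<alpha> \<equiv> mat2 1 \<alpha> 0 (1::'a)"
abbreviation L where "L \<alpha> \<equiv> mat2 1 0 \<alpha> (1::'a)"

definition unip :: "('a^2^2) set" where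
  "unip = generate G (U ` P \<union> L ` P)"

definition diags :: "('a^2^2) set" where
  "diags = {M \<in> X. M $ 1 $ 2 = 0 \<and> M $ 2 $ 1 = 0}"

lemma P_zero: "0 \<in> P"
  using P_diff[OF P_one P_one] by simp

lemma P_neg: "\<alpha> \<in> P \<Longrightarrow> - \<alpha> \<in> P"
  using P_diff[OF P_zero] by simp

lemma W_subgroup: "subgroup (W_group G P) G"
  unfolding W_group_def by (rule generate_is_subgroup) (use W_in in auto)

text \<open>The square of \<open>W_mat 0\<close> is minus the identity, so its cube is its inverse.
  Multiplying \<open>W_mat\<close> by this inverse on the right or on the left gives the upper or
  lower unipotents.\<close>

lemma UL_in_W:
  assumes "\<alpha> \<in> P"
  shows "U \<alpha> \<in> W_group G P" "L \<alpha> \<in> W_group G P"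
proof -
  have W: "W_mat \<beta> \<in> W_group G P" if "\<beta> \<in> P" for \<beta>
    unfolding W_group_def using that by (intro generate.incl) simp
  note W_mult = subgroup.m_closed[OF W_subgroup, simplified]
  have "W_mat 0 ** W_mat 0 ** W_mat 0 \<in> W_group G P" by (intro W_mult W P_zero)
  then have W3: "mat2 0 (- 1) 1 0 \<in> W_group G P" by (simp add: W_mat_mat2 mat2_mult)
  show "U \<alpha> \<in> W_group G P"
    using W_mult[OF W[OF P_neg[OF assms]] W3] by (simp add: W_mat_mat2 mat2_mult)
  show "L \<alpha> \<in> W_group G P"
    using W_mult[OF W3 W[OF assms]] by (simp add: W_mat_mat2 mat2_mult)
qed

lemma UL_in_X: "\<alpha> \<in> P \<Longrightarrow> U \<alpha> \<in> X" "\<alpha> \<in> P \<Longrightarrow> L \<alpha> \<in> X"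
  using UL_in_W subgroup.subset[OF W_subgroup] by auto

lemma unip_subgroup: "subgroup unip G"
  unfolding unip_def by (rule generate_is_subgroup) (use UL_in_X in auto)

lemma unip_subset_W: "unip \<subseteq> W_group G P"
  unfolding unip_def by (rule generate_subgroup_incl[OF _ W_subgroup]) (use UL_in_W in auto)

lemma UL_in_unip: "\<alpha> \<in> P \<Longrightarrow> U \<alpha> \<in> unip" "\<alpha> \<in> P \<Longrightarrow> L \<alpha> \<in> unip"
  unfolding unip_def by (auto intro: generate.incl)

lemma inv_UL:
  assumes "\<alpha> \<in> P"
  shows "inv\<^bsub>G\<^esub> (U \<alpha>) = U (- \<alpha>)" "inv\<^bsub>G\<^esub> (L \<alpha>) = L (- \<alpha>)"
  using assms by (auto intro!: inv_equality simp: UL_in_X P_neg mat2_mult mat_1_mat2)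

lemma inverse_in_X:
  assumes "M \<in> X"
  shows "inv\<^bsub>G\<^esub> M \<in> X" "inv\<^bsub>G\<^esub> M ** M = mat 1" "M ** inv\<^bsub>G\<^esub> M = mat 1"
  using assms by auto

lemma diags_cases:
  assumes "M \<in> diags"
  obtains a d where "M = mat2 a 0 0 d" "a \<noteq> 0" "d \<noteq> 0" "a \<in> R" "d \<in> R" "inverse a \<in> R" "inverse d \<in> R"
proof -
  have M: "M \<in> X" "M $ 1 $ 2 = 0" "M $ 2 $ 1 = 0" using assms by (auto simp: diags_def)
  have R: "M $ i $ j \<in> R" "(inv\<^bsub>G\<^esub> M) $ i $ j \<in> R" for i j
    using M(1) inverse_in_X(1)[OF M(1)] X_entries by (auto simp: mat2_over_def)
  have "M = mat2 (M $ 1 $ 1) 0 0 (M $ 2 $ 2)" using M by (intro mat2_eqI) auto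
  then show ?thesis
    using that triangular_unit_entries(1)[OF inverse_in_X(2,3)[OF M(1)] M(3)] R by metis
qed

text \<open>The squared norm of \<open>inverse a\<close> is a positive integer, hence at least
  1.\<close>

lemma norm_unit:
  assumes "a \<in> R" "inverse a \<in> R" "a \<noteq> 0"
  shows "norm a \<le> 1"
proof -
  obtain n where n: "(norm (inverse a))\<^sup>2 = of_int n" using R_norm[OF assms(2)] by (elim Ints_cases)
  have "(norm (inverse a))\<^sup>2 > 0" using assms(3) by simp
  then have "(norm (inverse a))\<^sup>2 \<ge> 1" unfolding n by simp
  then have "1 \<le> norm (inverse a)" by (metis norm_ge_zero one_power2 power2_le_imp_le)
  then show ?thesis using assms(3) by (simp add: norm_inverse one_le_inverse_iff)
qed

lemma finite_diags: "finite diags"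
proof (rule finite_subset)
  let ?F = "{x \<in> R. norm x \<le> 1}"
  show "diags \<subseteq> (\<lambda>(a, d). mat2 a 0 0 d) ` (?F \<times> ?F)"
    by (auto elim!: diags_cases intro!: norm_unit)
  show "finite \<dots>"
    using finite_unit_ball_if_norm_square_integral[OF R_diff R_norm] by auto
qed

lemma diags_in_X: "M \<in> diags \<Longrightarrow> M \<in> X"
  by (simp add: diags_def)

lemma diags_mult: "M \<in> diags \<Longrightarrow> N \<in> diags \<Longrightarrow> M ** N \<in> diags"
  using m_closed[of M N] by (simp add: diags_def) (simp add: matrix_matrix_mult_def sum_2)

text \<open>Conjugation by the diagonal matrix (a, d) turns the parameter \<alpha> into a \<alpha>
  d^{-1} for upper and d \<alpha> a^{-1} for lower unipotents; \<open>diag_in\<close> keeps both in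
  \<open>P\<close>.\<close>

lemma diags_conj_UL:
  assumes M: "M \<in> diags" and \<alpha>: "\<alpha> \<in> P"
  shows "\<exists>\<beta>\<in>P. M ** U \<alpha> = U \<beta> ** M" "\<exists>\<beta>\<in>P. M ** L \<alpha> = L \<beta> ** M"
proof -
  obtain a d where ad: "M = mat2 a 0 0 d" "a \<noteq> 0" "d \<noteq> 0" using M by (rule diags_cases)
  have P: "a * \<alpha> * inverse d \<in> P" "d * \<alpha> * inverse a \<in> P"
    using diag_in[OF diags_in_X[OF M] _ _ \<alpha>] ad(1) by simp_all
  have "M ** U \<alpha> = U (a * \<alpha> * inverse d) ** M" "M ** L \<alpha> = L (d * \<alpha> * inverse a) ** M"
    using ad(2,3) by (simp_all add: ad(1) mat2_mult mult.assoc)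
  with P show "\<exists>\<beta>\<in>P. M ** U \<alpha> = U \<beta> ** M" "\<exists>\<beta>\<in>P. M ** L \<alpha> = L \<beta> ** M" by blast+
qed

lemma diags_conj_unip:
  assumes M: "M \<in> diags" and N: "N \<in> unip"
  shows "\<exists>N'\<in>unip. M ** N = N' ** M"
  using N unfolding unip_def
proof (induction rule: generate.induct)
  case one
  then show ?case using generate.one[of G] by (auto intro!: bexI[of _ "mat 1"])
next
  case (incl h)
  then show ?case using diags_conj_UL[OF M] UL_in_unip unfolding unip_def by blast
next
  case (inv h)
  then obtain \<alpha> where "\<alpha> \<in> P" "h = U \<alpha> \<or> h = L \<alpha>" by auto
  then show ?case using diags_conj_UL[OF M P_neg] inv_UL UL_in_unip unfolding unip_def by metis
next
  case (eng h1 h2)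
  then obtain k1 k2 where k: "k1 \<in> generate G (U ` P \<union> L ` P)" "k2 \<in> generate G (U ` P \<union> L ` P)"
    "M ** h1 = k1 ** M" "M ** h2 = k2 ** M" by blast
  have "M ** (h1 ** h2) = (k1 ** k2) ** M"
    by (metis k(3,4) matrix_mul_assoc)
  then show ?case using generate.eng[OF k(1,2)] by auto
qed

text \<open>One row operation by a unipotent clears the off-diagonal entry; \<open>upper_in\<close>
  and \<open>lower_in\<close> put its coefficient into \<open>P\<close>.\<close>

lemma triangular_in_unip_diags:
  assumes M: "M \<in> X" "M $ 2 $ 1 = 0 \<or> M $ 1 $ 2 = 0"
  shows "\<exists>N\<in>unip. \<exists>D\<in>diags. M = N ** D"
  using M(2)
proof
  assume z: "M $ 2 $ 1 = 0"
  define \<beta> where "\<beta> = M $ 1 $ 2 * inverse (M $ 2 $ 2)"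
  have \<beta>: "\<beta> \<in> P" unfolding \<beta>_def using M(1) z by (rule upper_in)
  have "M $ 2 $ 2 \<noteq> 0" using triangular_unit_entries(1)[OF inverse_in_X(2,3)[OF M(1)] z] by simp
  then have "U (- \<beta>) ** M = mat2 (M $ 1 $ 1) 0 0 (M $ 2 $ 2)"
    using z by (intro mat2_eqI) (simp_all add: \<beta>_def matrix_matrix_mult_def sum_2 mult.assoc)
  moreover have "U (- \<beta>) ** M \<in> X" using UL_in_X(1)[OF P_neg[OF \<beta>]] M(1) by (rule m_closed)
  ultimately have "U (- \<beta>) ** M \<in> diags" by (simp add: diags_def)
  moreover have "M = U \<beta> ** (U (- \<beta>) ** M)"
    by (simp add: matrix_mul_assoc mat2_mult flip: mat_1_mat2)
  ultimately show ?thesis using UL_in_unip(1)[OF \<beta>] by blast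
next
  assume z: "M $ 1 $ 2 = 0"
  define \<beta> where "\<beta> = M $ 2 $ 1 * inverse (M $ 1 $ 1)"
  have \<beta>: "\<beta> \<in> P" unfolding \<beta>_def using M(1) z by (rule lower_in)
  have "M $ 1 $ 1 \<noteq> 0" using triangular_unit_entries(2)[OF inverse_in_X(2,3)[OF M(1)] z] by simp
  then have "L (- \<beta>) ** M = mat2 (M $ 1 $ 1) 0 0 (M $ 2 $ 2)"
    using z by (intro mat2_eqI) (simp_all add: \<beta>_def matrix_matrix_mult_def sum_2 mult.assoc)
  moreover have "L (- \<beta>) ** M \<in> X" using UL_in_X(2)[OF P_neg[OF \<beta>]] M(1) by (rule m_closed)
  ultimately have "L (- \<beta>) ** M \<in> diags" by (simp add: diags_def)
  moreover have "M = L \<beta> ** (L (- \<beta>) ** M)"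
    by (simp add: matrix_mul_assoc mat2_mult flip: mat_1_mat2)
  ultimately show ?thesis using UL_in_unip(2)[OF \<beta>] by blast
qed

lemma elementary_subgroup_G: "subgroup (elementary_subgroup G) G"
  unfolding elementary_subgroup_def by (rule generate_is_subgroup) auto

text \<open>The product set absorbs multiplication because N D N' D' = (N N'') (D D') once D is
  moved past N'. Inverses of generators need no separate argument, being triangular of the same
  shape.\<close>

lemma elementary_subset: "elementary_subgroup G \<subseteq> unip <#>\<^bsub>G\<^esub> diags"
proof
  fix M assume "M \<in> elementary_subgroup G"
  then have "\<exists>N\<in>unip. \<exists>D\<in>diags. M = N ** D"
    unfolding elementary_subgroup_def
  proof (induction rule: generate.induct)
    case one
    have "mat 1 \<in> diags" using one_closed by (simp add: diags_def mat_def)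
    then show ?case using subgroup.one_closed[OF unip_subgroup] by (auto intro!: bexI[of _ "mat 1"])
  next
    case (incl M)
    then show ?case by (intro triangular_in_unip_diags) auto
  next
    case (inv M)
    then have "M \<in> X" "M $ 2 $ 1 = 0 \<or> M $ 1 $ 2 = 0" by auto
    then show ?case
      using triangular_unit_entries[OF inverse_in_X(2,3)] inverse_in_X(1)
      by (intro triangular_in_unip_diags) blast+
  next
    case (eng M M')
    then obtain N D N' D' where ND: "N \<in> unip" "D \<in> diags" "M = N ** D"
      "N' \<in> unip" "D' \<in> diags" "M' = N' ** D'" by blast
    then obtain N'' where N'': "N'' \<in> unip" "D ** N' = N'' ** D" using diags_conj_unip by blast
    have "M ** M' = (N ** N'') ** (D ** D')"
      by (metis ND(3,6) N''(2) matrix_mul_assoc)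
    moreover have "N ** N'' \<in> unip"
      using subgroup.m_closed[OF unip_subgroup ND(1) N''(1)] by simp
    ultimately show ?case using diags_mult[OF ND(2,5)] by auto
  qed
  then show "M \<in> unip <#>\<^bsub>G\<^esub> diags" by (auto simp: set_mult_def)
qed

section \<open>The contradiction with finite index\<close>

lemma finite_index_pow_in_unip:
  assumes fin: "finite (rcosets\<^bsub>G\<^esub> (elementary_subgroup G))" and g: "g \<in> X"
  shows "\<exists>n::nat>0. g [^]\<^bsub>G\<^esub> n \<in> unip"
proof -
  obtain n :: nat where n: "n > 0" "g [^]\<^bsub>G\<^esub> n \<in> elementary_subgroup G"
    using finite_index_imp_pow_in[OF elementary_subgroup_G fin] g by auto
  have "(g [^]\<^bsub>G\<^esub> n) [^]\<^bsub>G\<^esub> k \<in> elementary_subgroup G" for k :: nat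
    using n(2) subgroup.one_closed[OF elementary_subgroup_G] subgroup.m_closed[OF elementary_subgroup_G]
    by (induction k) simp_all
  \<comment> \<open>All powers of g^n lie in \<open>unip\<close> times the finite set
    \<open>diags\<close>, so a second pigeonhole removes the diagonal factor.\<close>
  then obtain k :: nat where "k > 0" "(g [^]\<^bsub>G\<^esub> n) [^]\<^bsub>G\<^esub> k \<in> unip"
    using pow_in_set_mult_finite[OF unip_subgroup finite_diags, of "g [^]\<^bsub>G\<^esub> n"]
      subsetD[OF elementary_subset] nat_pow_closed[OF g] subsetI[of diags X, OF diags_in_X] by blast
  then show ?thesis using n(1) g by (intro exI[of _ "n * k"]) (simp add: nat_pow_pow)
qed

lemma infinite_index:
  assumes u: "u \<in> P" "u \<noteq> 0" and B: "B \<in> open_balls P" and avoid: "orbit_avoids_ball G P u B"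
  shows "infinite_index_subgroup (elementary_subgroup G) G"
  unfolding infinite_index_subgroup_def
proof (intro conjI elementary_subgroup_G notI)
  assume fin: "finite (rcosets\<^bsub>G\<^esub> (elementary_subgroup G))"
  obtain c r where cr: "c \<in> span P" "r > 0" "B = ball c r \<inter> span P"
    using B by (auto simp: open_balls_def)
  obtain s and n :: nat where s: "s \<in> P" "n > 0"
    "s /\<^sub>R of_nat n \<in> ball c r" "inner (s /\<^sub>R of_nat n) u \<noteq> 0"
    using rational_point_off_hyperplane[OF P_diff u cr(1,2)] by blast
  define p where "p = s /\<^sub>R of_nat n"
  have p: "p \<in> span P" using s(1) by (simp add: p_def span_base span_scale)
  have "parab p ((of_nat n)\<^sup>2) \<in> X" using parab_in[OF s(1,2)] by (simp add: p_def)
  then obtain k :: nat where k: "k > 0" "parab p ((of_nat n)\<^sup>2) [^]\<^bsub>G\<^esub> k \<in> unip"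
    using finite_index_pow_in_unip[OF fin] by blast
  define t where "t = of_nat k * (real n)\<^sup>2"
  \<comment> \<open>As a positive integer, \<open>t\<close> is at least 1, so m t exceeds the
    threshold \<open>T\<close> as soon as m does.\<close>
  have "1 \<le> real (k * n\<^sup>2)" using k(1) s(2) by (simp add: Suc_le_eq del: of_nat_mult of_nat_power)
  then have t: "t \<ge> 1" by (simp add: t_def)
  have t_unip: "parab p t \<in> unip" using k(2) unfolding parab_pow t_def .
  have pow: "parab p (of_nat m * t) \<in> unip" for m :: nat
  proof (induction m)
    case 0
    then show ?case using subgroup.one_closed[OF unip_subgroup] by (simp add: parab_0)
  next
    case (Suc m)
    then show ?case
      using subgroup.m_closed[OF unip_subgroup Suc t_unip] by (simp add: parab_add algebra_simps)
  qed
  obtain T where T: "\<And>t. t > T \<Longrightarrow> moebius (parab p t) ` S_plane P u \<subseteq> Some ` B"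
    using parab_contracts_hyperplane[OF p _ _ P_one P_span_inverse] s(3,4) unfolding cr(3) p_def by blast
  obtain m :: nat where m: "real m > T" using reals_Archimedean2 by blast
  have "real m \<le> real m * t" using t mult_left_mono[of 1 t "real m"] by simp
  then have "moebius (parab p (of_nat m * t)) ` S_plane P u \<subseteq> Some ` B" using m by (intro T) simp
  then show False using avoid pow[of m] unip_subset_W unfolding orbit_avoids_ball_def by blast
qed

end

text \<open>The case P = R: the diagonal entries of a triangular matrix in the group are units of
  \<open>R\<close>, so the stability conditions on \<open>P\<close> reduce to closure of
  \<open>R\<close> under products.\<close>

lemma elementary_setting_full:
  fixes X :: "('a::{real_normed_div_algebra,euclidean_space}^2^2) set"
  assumes grp: "group (matrix_group X)" and X: "X \<subseteq> mat2_over R"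
    and one: "1 \<in> R" and diff: "\<And>x y. x \<in> R \<Longrightarrow> y \<in> R \<Longrightarrow> x - y \<in> R"
    and mult: "\<And>x y. x \<in> R \<Longrightarrow> y \<in> R \<Longrightarrow> x * y \<in> R"
    and norm: "\<And>x. x \<in> R \<Longrightarrow> (norm x)\<^sup>2 \<in> \<int>"
    and inv: "\<And>x. x \<in> span R \<Longrightarrow> inverse x \<in> span R"
    and W: "\<And>\<alpha>. \<alpha> \<in> R \<Longrightarrow> W_mat \<alpha> \<in> X"
    and parab: "\<And>s n. s \<in> R \<Longrightarrow> n > 0 \<Longrightarrow> parab (s /\<^sub>R of_nat n) ((of_nat n)\<^sup>2) \<in> X"
  shows "elementary_setting X R R"
proof -
  have entry: "M $ i $ j \<in> R" if "M \<in> X" for M i j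
    using that X by (auto simp: mat2_over_def)
  have unit: "inverse (M $ 1 $ 1) \<in> R \<and> inverse (M $ 2 $ 2) \<in> R"
    if M: "M \<in> X" "M $ 1 $ 2 = 0 \<or> M $ 2 $ 1 = 0" for M
  proof -
    interpret group "matrix_group X" by (rule grp)
    obtain N where "N \<in> X" "N ** M = mat 1" "M ** N = mat 1"
      using M(1) by (metis inv_closed l_inv matrix_group_simps r_inv)
    then show ?thesis using triangular_unit_entries[of N M] M(2) entry by metis
  qed
  show ?thesis
    by (rule elementary_setting.intro) (use assms entry unit in \<open>auto intro!: mult\<close>)
qed

section \<open>Orders in definite quaternion algebras\<close>

text \<open>The inverse is (tr x - x) / |x|^2, a real combination of 1 and x, so every real subspace
  containing 1 is closed under inversion. The quaternions satisfy the same identity.\<close>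

lemma span_inverse_complex:
  fixes P :: "complex set"
  assumes "1 \<in> P" and x: "x \<in> span P"
  shows "inverse x \<in> span P"
proof -
  have "inverse x = (1 / (cmod x)\<^sup>2) *\<^sub>R ((2 * Re x) *\<^sub>R 1 - x)"
    by (simp add: complex_eq_iff cmod_power2 divide_inverse algebra_simps)
  then show ?thesis using assms by (simp add: span_scale span_diff span_base)
qed

lemma span_inverse_quat:
  fixes P :: "quat set"
  assumes "1 \<in> P" and x: "x \<in> span P"
  shows "inverse x \<in> span P"
proof -
  have "qcnj x = (2 * q1 x) *\<^sub>R 1 - x" by (simp add: quat_eq_iff)
  then have "inverse x = (1 / inner x x) *\<^sub>R ((2 * q1 x) *\<^sub>R 1 - x)"
    by (simp add: inverse_quat_def)
  then show ?thesis using assms by (simp add: span_scale span_diff span_base)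
qed

lemma qcnj_mult: "qcnj (x * y) = qcnj y * qcnj x"
  by (simp add: quat_eq_iff quat_sel_times algebra_simps)

lemma qcnj_qcnj [simp]: "qcnj (qcnj x) = x"
  by (simp add: quat_eq_iff)

lemma qdag_sel [simp]:
  "q1 (qdag x) = q1 x" "qi (qdag x) = qi x" "qj (qdag x) = qj x" "qk (qdag x) = - qk x"
  by (simp_all add: qdag_def)

lemma qdag_simps [simp]:
  "qdag 0 = 0" "qdag 1 = 1" "qdag (qdag x) = x" "qdag (x + y) = qdag x + qdag y"
  "qdag (x - y) = qdag x - qdag y" "qdag (- x) = - qdag x" "qdag (r *\<^sub>R x) = r *\<^sub>R qdag x"
  by (simp_all add: quat_eq_iff)

lemma of_int_in_ring:
  fixes R :: "'a::ring_1 set"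
  assumes one: "1 \<in> R" and diff: "\<And>x y. x \<in> R \<Longrightarrow> y \<in> R \<Longrightarrow> x - y \<in> R"
  shows "of_int k \<in> R"
proof -
  have zero: "0 \<in> R" using diff[OF one one] by simp
  have add: "x + y \<in> R" if "x \<in> R" "y \<in> R" for x y
    using diff[OF that(1) diff[OF zero that(2)]] by simp
  have "of_nat n \<in> R" for n by (induction n) (auto intro: zero one add)
  then show ?thesis
    using diff[OF zero] by (cases k rule: int_cases2) (auto simp: )
qed

text \<open>The basis 1, I, J, IJ is orthogonal with the rational squared lengths 1, -a, -b,
  ab.\<close>

lemma quaternion_algebra_inner_rat:
  assumes ab: "a < 0" "b < 0" and x: "x \<in> quaternion_algebra a b" and y: "y \<in> quaternion_algebra a b"
  shows "inner x y \<in> \<rat>"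
proof -
  have sq: "sqrt (- of_rat c) * sqrt (- of_rat c) = - of_rat c" if "c < 0" for c
    using that by (intro real_sqrt_mult_self[THEN trans] abs_of_nonneg) simp
  obtain x1 x2 x3 x4 where x: "x = of_rat x1 *\<^sub>R 1 + of_rat x2 *\<^sub>R gen_I a + of_rat x3 *\<^sub>R gen_J b
      + of_rat x4 *\<^sub>R (gen_I a * gen_J b)"
    using x by (auto simp: quaternion_algebra_def)
  obtain y1 y2 y3 y4 where y: "y = of_rat y1 *\<^sub>R 1 + of_rat y2 *\<^sub>R gen_I a + of_rat y3 *\<^sub>R gen_J b
      + of_rat y4 *\<^sub>R (gen_I a * gen_J b)"
    using y by (auto simp: quaternion_algebra_def)
  define p where "p = sqrt (- of_rat a)"
  define q where "q = sqrt (- of_rat b)"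
  have "inner x y = of_rat x1 * of_rat y1 + of_rat x2 * of_rat y2 * (p * p)
      + of_rat x3 * of_rat y3 * (q * q) + of_rat x4 * of_rat y4 * ((p * p) * (q * q))"
    unfolding x y gen_I_def gen_J_def p_def[symmetric] q_def[symmetric]
    by (simp add: inner_quat_def quat_sel_times)
  also have "\<dots> \<in> \<rat>" unfolding p_def q_def sq[OF ab(1)] sq[OF ab(2)] by simp
  finally show ?thesis .
qed

context
  fixes a b R
  assumes ab: "a < 0" "b < 0" and ord: "is_order (quaternion_algebra a b) R"
begin

lemma order_one: "1 \<in> R"
  and order_diff: "x \<in> R \<Longrightarrow> y \<in> R \<Longrightarrow> x - y \<in> R"
  and order_mult: "x \<in> R \<Longrightarrow> y \<in> R \<Longrightarrow> x * y \<in> R"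
  using ord by (auto simp: is_order_def)

lemma order_norm: "x \<in> R \<Longrightarrow> (norm x)\<^sup>2 \<in> \<int>"
proof -
  assume x: "x \<in> R"
  obtain S where S: "finite S" "R = int_span S"
    using ord by (auto simp: is_order_def)
  have "S \<subseteq> quaternion_algebra a b"
    using ord S(2) int_span_base[of _ S] by (auto simp: is_order_def)
  then have "inner s t \<in> \<rat>" if "s \<in> S" "t \<in> S" for s t
    using that by (intro quaternion_algebra_inner_rat[OF ab]) auto
  then show ?thesis
    using x order_one order_mult by (intro norm_square_integral[OF S(1)]) (simp_all flip: S(2))
qed

lemma order_of_int: "of_int k \<in> R"
  by (intro of_int_in_ring order_one order_diff)

text \<open>The conjugate is the trace minus x, so an integral trace suffices. By polarisation the
  trace is |x + 1|^2 - |x|^2 - 1; here x + 1 is written as \<open>x - of_int (- 1)\<close> to fit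
  closure under differences.\<close>

lemma order_qcnj:
  assumes x: "x \<in> R"
  shows "qcnj x \<in> R"
proof -
  have "(norm (x - of_int (- 1)))\<^sup>2 - (norm x)\<^sup>2 - 1 \<in> \<int>"
    by (intro Ints_diff order_norm order_diff order_of_int x Ints_1)
  moreover have "(norm (x - of_int (- 1)))\<^sup>2 - (norm x)\<^sup>2 - 1 = 2 * q1 x"
    unfolding power2_norm_eq_inner by (simp add: inner_quat_def algebra_simps)
  ultimately obtain k where k: "2 * q1 x = of_int k" by (metis Ints_cases)
  have "(of_int k :: quat) = (2 * q1 x) *\<^sub>R 1" by (simp add: k scaleR_conv_of_real)
  then have "qcnj x = of_int k - x" by (simp add: quat_eq_iff)
  then show ?thesis using order_diff[OF order_of_int x] by simp
qed

end

lemma block_matrix_mult: "block_matrix (M ** N) = block_matrix M ** block_matrix N"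
proof -
  have "sum f (UNIV :: (2 \<times> 2) set) = (\<Sum>i\<in>UNIV. \<Sum>j\<in>UNIV. f (i, j))" for f :: "2 \<times> 2 \<Rightarrow> complex"
    by (simp add: sum.cartesian_product)
  then show ?thesis
    by (simp add: vec_eq_iff block_matrix_def matrix_matrix_mult_def sum_2 quat_to_mat_hom)
qed

lemma block_matrix_one: "block_matrix (mat 1) = mat 1"
proof -
  have "quat_to_mat 0 = 0"
    by (simp add: vec_eq_iff forall_2 quat_to_mat_def complex_eq_iff)
  then show ?thesis
    by (auto simp: vec_eq_iff block_matrix_def mat_def quat_to_mat_hom(1))
qed

section \<open>The group defined by the involution (dimension 4)\<close>

lemma dag_hat_mult: "dag_hat (M ** N) = dag_hat N ** dag_hat M"
proof -
  obtain a b c d where M: "M = mat2 a b c d" by (rule mat2_cases)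
  obtain a' b' c' d' where N: "N = mat2 a' b' c' d'" by (rule mat2_cases)
  show ?thesis by (simp add: M N mat2_mult qdag_mult algebra_simps)
qed

lemma dag_hat_dag_hat: "dag_hat (dag_hat M) = M"
  by (rule mat2_cases[of M]) simp

lemma dag_hat_one: "dag_hat (mat 1) = mat 1"
  by (simp add: mat_1_mat2)

lemma dag_hat_parab: "qdag p = p \<Longrightarrow> dag_hat (parab p t) = parab p (- t)"
  by (simp add: parab_def qdag_mult)

text \<open>In this group \<open>dag_hat M\<close> is the inverse of \<open>M\<close>, so for
  triangular \<open>M\<close> the inverse of one diagonal entry is \<open>qdag\<close> of the other.
  Conjugation by a diagonal matrix then acts by \<alpha> \<mapsto>
  \<open>a * \<alpha> * qdag a\<close>, which preserves the fixed elements.\<close>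

lemma elementary_setting_dag:
  assumes ab: "a < 0" "b < 0" and R: "maximal_dag_order (quaternion_algebra a b) R"
  shows "elementary_setting {M \<in> mat2_over R. dag_hat M ** M = mat 1 \<and> M ** dag_hat M = mat 1}
    R (dag_fixed R)"
proof -
  define X where "X = {M \<in> mat2_over R. dag_hat M ** M = mat 1 \<and> M ** dag_hat M = mat 1}"
  have ord: "is_order (quaternion_algebra a b) R" and dagR: "qdag ` R = R"
    using R by (auto simp: maximal_dag_order_def dag_order_def)
  note one = order_one[OF ab ord] and diff = order_diff[OF ab ord] and mult = order_mult[OF ab ord]
    and of_int = order_of_int[OF ab ord]
  have zero: "0 \<in> R" using of_int[of 0] by simp
  have neg: "- x \<in> R" if "x \<in> R" for x using diff[OF zero that] by simp
  have add: "x + y \<in> R" if "x \<in> R" "y \<in> R" for x y using diff[OF that(1) neg[OF that(2)]] by simp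
  have of_nat: "of_nat n \<in> R" for n using of_int[of "int n"] by simp
  have dag: "qdag x \<in> R" if "x \<in> R" for x using that dagR by blast
  have over_mult: "M ** N \<in> mat2_over R" if "M \<in> mat2_over R" "N \<in> mat2_over R" for M N
    using that by (auto simp: mat2_over_def matrix_matrix_mult_def sum_2 intro!: add mult)
  have over_dag: "dag_hat M \<in> mat2_over R" if "M \<in> mat2_over R" for M
    using that by (cases M rule: mat2_cases) (auto intro!: neg dag)
  have XI: "M \<in> X" if "M \<in> mat2_over R" "dag_hat M ** M = mat 1" "M ** dag_hat M = mat 1" for M
    using that by (simp add: X_def)
  have grp: "group (matrix_group X)"
  proof (rule group_matrix_groupI)
    show "mat 1 \<in> X" by (rule XI) (simp_all add: dag_hat_one, simp add: mat_1_mat2 one zero)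
    show "M ** N \<in> X" if M: "M \<in> X" and N: "N \<in> X" for M N
    proof (rule XI)
      show "M ** N \<in> mat2_over R" using M N over_mult by (simp add: X_def)
      have "dag_hat (M ** N) ** (M ** N) = dag_hat N ** (dag_hat M ** M) ** N"
        by (simp add: dag_hat_mult matrix_mul_assoc)
      then show "dag_hat (M ** N) ** (M ** N) = mat 1" using M N by (simp add: X_def)
      have "(M ** N) ** dag_hat (M ** N) = M ** (N ** dag_hat N) ** dag_hat M"
        by (simp add: dag_hat_mult matrix_mul_assoc)
      then show "(M ** N) ** dag_hat (M ** N) = mat 1" using M N by (simp add: X_def)
    qed
    show "\<exists>N\<in>X. N ** M = mat 1" if "M \<in> X" for M
      using that over_dag by (intro bexI[of _ "dag_hat M"]) (auto simp: X_def dag_hat_dag_hat)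
  qed
  have tri: "inverse (M $ 1 $ 1) = qdag (M $ 2 $ 2) \<and> inverse (M $ 2 $ 2) = qdag (M $ 1 $ 1)"
    if "M \<in> X" "M $ 1 $ 2 = 0 \<or> M $ 2 $ 1 = 0" for M
    using triangular_unit_entries[of "dag_hat M" M] that
    by (cases M rule: mat2_cases) (auto simp: X_def)
  have "elementary_setting X R (dag_fixed R)"
  proof (rule elementary_setting.intro)
    show "group (matrix_group X)" by (rule grp)
    show "X \<subseteq> mat2_over R" by (auto simp: X_def)
    show "x - y \<in> R" if "x \<in> R" "y \<in> R" for x y using that by (rule diff)
    show "(norm x)\<^sup>2 \<in> \<int>" if "x \<in> R" for x using that by (rule order_norm[OF ab ord])
    show "x - y \<in> dag_fixed R" if "x \<in> dag_fixed R" "y \<in> dag_fixed R" for x y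
      using that diff by (auto simp: dag_fixed_def)
    show P1: "1 \<in> dag_fixed R" using one by (auto simp: dag_fixed_def)
    show "inverse x \<in> span (dag_fixed R)" if "x \<in> span (dag_fixed R)" for x
      using P1 that by (rule span_inverse_quat)
    show "W_mat \<alpha> \<in> X" if "\<alpha> \<in> dag_fixed R" for \<alpha>
      using that one zero neg
      by (auto simp: X_def dag_fixed_def W_mat_mat2 mat2_mult mat_1_mat2)
    show "parab (s /\<^sub>R of_nat n) ((of_nat n)\<^sup>2) \<in> X" if s: "s \<in> dag_fixed R" and n: "n > 0" for s n
    proof (rule XI)
      have "s \<in> R" using s by (simp add: dag_fixed_def)
      then show "parab (s /\<^sub>R of_nat n) ((of_nat n)\<^sup>2) \<in> mat2_over R"
        unfolding parab_integral_entries[OF n] mat2_in_mat2_over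
        by (intro conjI add diff mult neg one of_nat)
    qed (use s in \<open>simp_all add: dag_fixed_def dag_hat_parab parab_add parab_0\<close>)
    have ent: "M $ i $ j \<in> R" if "M \<in> X" for M i j
      using that by (auto simp: X_def mat2_over_def)
    show "M $ 1 $ 2 * inverse (M $ 2 $ 2) \<in> dag_fixed R" if M: "M \<in> X" "M $ 2 $ 1 = 0" for M
    proof -
      \<comment> \<open>The upper right entry of \<open>M ** dag_hat M = mat 1\<close> says
        precisely that this product is fixed by \<open>qdag\<close>; its second factor is the
        inverse of \<open>M $ 2 $ 2\<close>.\<close>
      have "M $ 1 $ 2 * qdag (M $ 1 $ 1) = M $ 1 $ 1 * qdag (M $ 1 $ 2)"
        using M by (cases M rule: mat2_cases) (auto simp: X_def mat2_mult mat_1_mat2)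
      then show ?thesis using tri[of M] M ent[OF M(1)] mult dag
        by (simp add: dag_fixed_def qdag_mult)
    qed
    show "M $ 2 $ 1 * inverse (M $ 1 $ 1) \<in> dag_fixed R" if M: "M \<in> X" "M $ 1 $ 2 = 0" for M
    proof -
      have "M $ 2 $ 1 * qdag (M $ 2 $ 2) = M $ 2 $ 2 * qdag (M $ 2 $ 1)"
        using M by (cases M rule: mat2_cases) (auto simp: X_def mat2_mult mat_1_mat2)
      then show ?thesis using tri[of M] M ent[OF M(1)] mult dag
        by (simp add: dag_fixed_def qdag_mult)
    qed
    show "M $ 1 $ 1 * \<alpha> * inverse (M $ 2 $ 2) \<in> dag_fixed R \<and>
        M $ 2 $ 2 * \<alpha> * inverse (M $ 1 $ 1) \<in> dag_fixed R"
      if M: "M \<in> X" "M $ 1 $ 2 = 0" "M $ 2 $ 1 = 0" and \<alpha>: "\<alpha> \<in> dag_fixed R" for M \<alpha>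
      using tri[of M] M(1,2) ent[OF M(1)] \<alpha> mult dag
      by (simp add: dag_fixed_def qdag_mult mult.assoc)
  qed
  then show ?thesis by (simp add: X_def)
qed

section \<open>Determinants and inverses of quaternionic matrices (dimension 5)\<close>

lemma det_2x2_index:
  fixes A :: "'a::comm_ring_1^(2 \<times> 2)^(2 \<times> 2)"
  shows "det A =
    A$(1,1)$(1,1) * A$(1,2)$(1,2) * A$(2,1)$(2,1) * A$(2,2)$(2,2)
  - A$(1,1)$(1,1) * A$(1,2)$(1,2) * A$(2,1)$(2,2) * A$(2,2)$(2,1)
  - A$(1,1)$(1,1) * A$(1,2)$(2,1) * A$(2,1)$(1,2) * A$(2,2)$(2,2)
  + A$(1,1)$(1,1) * A$(1,2)$(2,1) * A$(2,1)$(2,2) * A$(2,2)$(1,2)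
  + A$(1,1)$(1,1) * A$(1,2)$(2,2) * A$(2,1)$(1,2) * A$(2,2)$(2,1)
  - A$(1,1)$(1,1) * A$(1,2)$(2,2) * A$(2,1)$(2,1) * A$(2,2)$(1,2)
  - A$(1,1)$(1,2) * A$(1,2)$(1,1) * A$(2,1)$(2,1) * A$(2,2)$(2,2)
  + A$(1,1)$(1,2) * A$(1,2)$(1,1) * A$(2,1)$(2,2) * A$(2,2)$(2,1)
  + A$(1,1)$(1,2) * A$(1,2)$(2,1) * A$(2,1)$(1,1) * A$(2,2)$(2,2)
  - A$(1,1)$(1,2) * A$(1,2)$(2,1) * A$(2,1)$(2,2) * A$(2,2)$(1,1)
  - A$(1,1)$(1,2) * A$(1,2)$(2,2) * A$(2,1)$(1,1) * A$(2,2)$(2,1)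
  + A$(1,1)$(1,2) * A$(1,2)$(2,2) * A$(2,1)$(2,1) * A$(2,2)$(1,1)
  + A$(1,1)$(2,1) * A$(1,2)$(1,1) * A$(2,1)$(1,2) * A$(2,2)$(2,2)
  - A$(1,1)$(2,1) * A$(1,2)$(1,1) * A$(2,1)$(2,2) * A$(2,2)$(1,2)
  - A$(1,1)$(2,1) * A$(1,2)$(1,2) * A$(2,1)$(1,1) * A$(2,2)$(2,2)
  + A$(1,1)$(2,1) * A$(1,2)$(1,2) * A$(2,1)$(2,2) * A$(2,2)$(1,1)
  + A$(1,1)$(2,1) * A$(1,2)$(2,2) * A$(2,1)$(1,1) * A$(2,2)$(1,2)
  - A$(1,1)$(2,1) * A$(1,2)$(2,2) * A$(2,1)$(1,2) * A$(2,2)$(1,1)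
  - A$(1,1)$(2,2) * A$(1,2)$(1,1) * A$(2,1)$(1,2) * A$(2,2)$(2,1)
  + A$(1,1)$(2,2) * A$(1,2)$(1,1) * A$(2,1)$(2,1) * A$(2,2)$(1,2)
  + A$(1,1)$(2,2) * A$(1,2)$(1,2) * A$(2,1)$(1,1) * A$(2,2)$(2,1)
  - A$(1,1)$(2,2) * A$(1,2)$(1,2) * A$(2,1)$(2,1) * A$(2,2)$(1,1)
  - A$(1,1)$(2,2) * A$(1,2)$(2,1) * A$(2,1)$(1,1) * A$(2,2)$(1,2)
  + A$(1,1)$(2,2) * A$(1,2)$(2,1) * A$(2,1)$(1,2) * A$(2,2)$(1,1)"
proof -
  have U: "(UNIV :: (2 \<times> 2) set) = {(1,1), (1,2), (2,1), (2,2)}"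
    by (auto simp: UNIV_2 simp flip: UNIV_Times_UNIV)
  have f: "finite {(1,2), (2,1), (2,2) :: 2 \<times> 2}" "(1,1) \<notin> {(1,2), (2,1), (2,2) :: 2 \<times> 2}"
    "finite {(2,1), (2,2) :: 2 \<times> 2}" "(1,2) \<notin> {(2,1), (2,2) :: 2 \<times> 2}"
    "finite {(2,2) :: 2 \<times> 2}" "(2,1) \<notin> {(2,2) :: 2 \<times> 2}"
    by auto
  show ?thesis
    unfolding det_def U
    unfolding sum_over_permutations_insert[OF f(1,2)] sum_over_permutations_insert[OF f(3,4)]
      sum_over_permutations_insert[OF f(5,6)]
    unfolding permutes_sing
    by (simp add: sign_swap_id permutation_swap_id permutation_compose sign_compose sign_id swap_id_eq)
qed

text \<open>For nonzero a this is the Schur complement formula |a|^2 |d - c a^{-1} b|^2 multiplied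
  out, the square of the Dieudonne determinant.\<close>

lemma det_block_matrix_mat2:
  "det (block_matrix (mat2 a b c d)) =
    of_real (inner a a * inner d d + inner b b * inner c c - 2 * q1 (a * qcnj c * d * qcnj b))"
proof -
  have entries: "block_matrix M $ (i, j) $ (k, l) = quat_to_mat (M $ i $ k) $ j $ l" for M i j k l
    by (simp add: block_matrix_def)
  have q: "quat_to_mat x $ 1 $ 1 = Complex (q1 x) (qi x)" "quat_to_mat x $ 1 $ 2 = Complex (qj x) (qk x)"
    "quat_to_mat x $ 2 $ 1 = Complex (- qj x) (qk x)" "quat_to_mat x $ 2 $ 2 = Complex (q1 x) (- qi x)" for x
    by (simp_all add: quat_to_mat_def)
  show ?thesis
    unfolding det_2x2_index entries mat2_sel q complex_eq_iff
    by (simp add: inner_quat_def quat_sel_times) (simp add: algebra_simps)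
qed

lemma mult_qcnj_cancel:
  "x * (qcnj x * y) = inner x x *\<^sub>R y" "qcnj x * (x * y) = inner x x *\<^sub>R y"
  by (simp_all add: quat_times_qcnj flip: mult.assoc)

text \<open>The second factor is a quaternionic adjugate, polynomial in the entries and their
  conjugates, so for \<Delta> = 1 it is an inverse with entries in the order. Off the diagonal the
  terms cancel because \<open>x * qcnj x\<close> is real; on it they pair up as a quaternion plus
  its conjugate.\<close>

lemma mat2_mult_adjugate:
  fixes a b c d :: quat
  shows "mat2 a b c d **
    mat2 (inner d d *\<^sub>R qcnj a - qcnj c * d * qcnj b) (inner b b *\<^sub>R qcnj c - qcnj a * b * qcnj d)
      (inner c c *\<^sub>R qcnj b - qcnj d * c * qcnj a) (inner a a *\<^sub>R qcnj d - qcnj b * a * qcnj c) =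
    (let \<Delta> = inner a a * inner d d + inner b b * inner c c - 2 * q1 (a * qcnj c * d * qcnj b)
     in mat2 (\<Delta> *\<^sub>R 1) 0 0 (\<Delta> *\<^sub>R 1))"
proof -
  have trace: "x + qcnj x = (2 * q1 x) *\<^sub>R 1" for x
    by (simp add: quat_eq_iff)
  have cyc: "q1 (x * y) = q1 (y * x)" for x y by (simp add: quat_sel_times)
  have 1: "a * (qcnj c * (d * qcnj b)) + b * (qcnj d * (c * qcnj a)) =
      (2 * q1 (a * qcnj c * d * qcnj b)) *\<^sub>R 1"
    using trace[of "a * qcnj c * d * qcnj b"] by (simp add: qcnj_mult mult.assoc)
  \<comment> \<open>Conjugation reverses the product and a cyclic rotation restores the order;
    neither changes the real part.\<close>
  have "q1 (c * qcnj a * b * qcnj d) = q1 (a * qcnj c * d * qcnj b)"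
    using cyc[of "a * qcnj c" "d * qcnj b"]
      arg_cong[OF trace[of "a * qcnj c * d * qcnj b"], of q1] qcnj_sel(1)[of "d * qcnj b * (a * qcnj c)"]
    by (simp add: qcnj_mult mult.assoc)
  then have 2: "c * (qcnj a * (b * qcnj d)) + d * (qcnj b * (a * qcnj c)) =
      (2 * q1 (a * qcnj c * d * qcnj b)) *\<^sub>R 1"
    using trace[of "c * qcnj a * b * qcnj d"] by (simp add: qcnj_mult mult.assoc)
  have "a * (inner d d *\<^sub>R qcnj a - qcnj c * d * qcnj b) + b * (inner c c *\<^sub>R qcnj b - qcnj d * c * qcnj a) =
      (inner a a * inner d d + inner b b * inner c c) *\<^sub>R 1
        - (a * (qcnj c * (d * qcnj b)) + b * (qcnj d * (c * qcnj a)))"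
    by (simp add: right_diff_distrib quat_times_qcnj mult.assoc algebra_simps)
  moreover have "c * (inner b b *\<^sub>R qcnj c - qcnj a * b * qcnj d) + d * (inner a a *\<^sub>R qcnj d - qcnj b * a * qcnj c) =
      (inner a a * inner d d + inner b b * inner c c) *\<^sub>R 1
        - (c * (qcnj a * (b * qcnj d)) + d * (qcnj b * (a * qcnj c)))"
    by (simp add: right_diff_distrib quat_times_qcnj mult.assoc algebra_simps)
  moreover have "a * (inner b b *\<^sub>R qcnj c - qcnj a * b * qcnj d) + b * (inner a a *\<^sub>R qcnj d - qcnj b * a * qcnj c) = 0"
    by (simp add: right_diff_distrib mult_qcnj_cancel mult.assoc)
  moreover have "c * (inner d d *\<^sub>R qcnj a - qcnj c * d * qcnj b) + d * (inner c c *\<^sub>R qcnj b - qcnj d * c * qcnj a) = 0"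
    by (simp add: right_diff_distrib mult_qcnj_cancel mult.assoc)
  ultimately show ?thesis
    unfolding Let_def mat2_mult 1 2 by (simp add: scaleR_diff_left)
qed

lemma det_block_parab: "det (block_matrix (parab p t)) = 1"
  unfolding parab_def det_block_matrix_mat2
  by (simp add: inner_quat_def quat_sel_times algebra_simps)

lemma elementary_setting_quat:
  assumes ab: "a < 0" "b < 0" and R: "maximal_order (quaternion_algebra a b) R"
  shows "elementary_setting {M \<in> mat2_over R. det (block_matrix M) = 1} R R"
proof -
  have ord: "is_order (quaternion_algebra a b) R"
    using R by (auto simp: maximal_order_def)
  note one = order_one[OF ab ord] and diff = order_diff[OF ab ord] and mult = order_mult[OF ab ord]
    and of_int = order_of_int[OF ab ord] and norm = order_norm[OF ab ord] and cnj = order_qcnj[OF ab ord]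
  have zero: "0 \<in> R" using of_int[of 0] by simp
  have neg: "- x \<in> R" if "x \<in> R" for x using diff[OF zero that] by simp
  have add: "x + y \<in> R" if "x \<in> R" "y \<in> R" for x y using diff[OF that(1) neg[OF that(2)]] by simp
  have of_nat: "of_nat n \<in> R" for n using of_int[of "int n"] by simp
  have scale: "inner x x *\<^sub>R y \<in> R" if "x \<in> R" "y \<in> R" for x y
    using that by (simp add: mult cnj flip: mult_qcnj_cancel(1))
  let ?X = "{M \<in> mat2_over R. det (block_matrix M) = 1}"
  have X_mult: "M ** N \<in> ?X" if "M \<in> ?X" "N \<in> ?X" for M N
    using that by (auto simp: mat2_over_def block_matrix_mult det_mul)
      (auto simp: matrix_matrix_mult_def sum_2 intro!: add mult)
  have right: "\<exists>N\<in>?X. M ** N = mat 1" if MX: "M \<in> ?X" for M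
  proof -
    obtain a b c d where M: "M = mat2 a b c d" by (rule mat2_cases)
    have R: "a \<in> R" "b \<in> R" "c \<in> R" "d \<in> R" using MX by (auto simp: M)
    have \<Delta>: "inner a a * inner d d + inner b b * inner c c - 2 * q1 (a * qcnj c * d * qcnj b) = 1"
      using MX unfolding M mem_Collect_eq det_block_matrix_mat2 of_real_eq_1_iff by blast
    define N where "N = mat2 (inner d d *\<^sub>R qcnj a - qcnj c * d * qcnj b)
      (inner b b *\<^sub>R qcnj c - qcnj a * b * qcnj d) (inner c c *\<^sub>R qcnj b - qcnj d * c * qcnj a)
      (inner a a *\<^sub>R qcnj d - qcnj b * a * qcnj c)"
    have MN: "M ** N = mat 1" unfolding M N_def mat2_mult_adjugate \<Delta> Let_def by (simp add: mat_1_mat2)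
    have "det (block_matrix M) * det (block_matrix N) = 1"
      unfolding det_mul[symmetric] block_matrix_mult[symmetric] MN by (simp add: block_matrix_one)
    then have "N \<in> ?X" using MX R by (simp add: N_def diff mult cnj scale)
    then show ?thesis using MN by blast
  qed
  show ?thesis
  proof (rule elementary_setting_full)
    show "group (matrix_group ?X)"
    proof (rule group_matrix_groupI)
      show "mat 1 \<in> ?X" by (simp add: block_matrix_one) (simp add: one zero mat_1_mat2)
      show "M ** N \<in> ?X" if "M \<in> ?X" "N \<in> ?X" for M N using that by (rule X_mult)
      show "\<exists>N\<in>?X. N ** M = mat 1" if M: "M \<in> ?X" for M
      proof -
        obtain N where N: "N \<in> ?X" "M ** N = mat 1" using right[OF M] by blast
        obtain L where L: "N ** L = mat 1" using right[OF N(1)] by blast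
        \<comment> \<open>A right inverse that itself has a right inverse is two-sided.\<close>
        have "L = M" using N(2) L by (metis matrix_mul_assoc matrix_mul_lid matrix_mul_rid)
        then show ?thesis using N(1) L by blast
      qed
    qed
    show "?X \<subseteq> mat2_over R" by auto
    show "inverse x \<in> span R" if "x \<in> span R" for x using one that by (rule span_inverse_quat)
    show "W_mat \<alpha> \<in> ?X" if "\<alpha> \<in> R" for \<alpha>
      using that one zero neg by (simp add: W_mat_mat2 det_block_matrix_mat2 inner_quat_def)
    show "parab (s /\<^sub>R of_nat n) ((of_nat n)\<^sup>2) \<in> ?X" if "s \<in> R" "n > 0" for s n
    proof -
      have "parab (s /\<^sub>R of_nat n) ((of_nat n)\<^sup>2) \<in> mat2_over R"
        unfolding parab_integral_entries[OF that(2)] mat2_in_mat2_over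
        using that(1) by (intro conjI add diff mult neg one of_nat)
      then show ?thesis by (simp add: det_block_parab)
    qed
  qed (fact one diff mult norm)+
qed

section \<open>Imaginary quadratic fields\<close>

lemma quadratic_trace_mult_cnj:
  fixes x y x' y' d :: real
  assumes rat: "y \<in> \<rat>" "y' \<in> \<rat>" and d: "d \<in> \<rat>"
    and tr: "2 * x \<in> \<int>" "2 * x' \<in> \<int>" and nrm: "x\<^sup>2 + d * y\<^sup>2 \<in> \<int>" "x'\<^sup>2 + d * y'\<^sup>2 \<in> \<int>"
  shows "2 * (x * x' + d * y * y') \<in> \<int>"
proof -
  \<comment> \<open>With traces \<open>t, t'\<close> and norms \<open>n, n'\<close>, the rational number \<open>4 d y y'\<close> has the integer square
    \<open>(4 n - t\<^sup>2) (4 n' - t'\<^sup>2)\<close>, so it is an integer of the same parity as \<open>t t'\<close>.\<close>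
  obtain t t' n n' where t: "2 * x = of_int t" "2 * x' = of_int t'"
    and n: "x\<^sup>2 + d * y\<^sup>2 = of_int n" "x'\<^sup>2 + d * y'\<^sup>2 = of_int n'"
    using tr nrm by (metis Ints_cases)
  have A: "4 * d * y\<^sup>2 = of_int (4 * n - t\<^sup>2)" "4 * d * y'\<^sup>2 = of_int (4 * n' - t'\<^sup>2)"
    by (simp_all flip: n t add: power2_eq_square algebra_simps)
  have sq: "(4 * d * y * y')\<^sup>2 = of_int ((4 * n - t\<^sup>2) * (4 * n' - t'\<^sup>2))"
    unfolding of_int_mult A[symmetric] by (simp add: power2_eq_square)
  have "algebraic_int ((4 * d * y * y')\<^sup>2)" unfolding sq by (rule algebraic_int_of_int)
  then have "algebraic_int (4 * d * y * y')"
    by (rule algebraic_int_root[of _ "monom 1 2"]) (auto simp: poly_monom degree_monom_eq coeff_monom)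
  moreover have "4 * d * y * y' \<in> \<rat>" using rat d by simp
  ultimately have "4 * d * y * y' \<in> \<int>" by (rule rational_algebraic_int_is_int)
  then obtain c where c: "4 * d * y * y' = of_int c" by (elim Ints_cases)
  have "real_of_int (c\<^sup>2) = of_int ((4 * n - t\<^sup>2) * (4 * n' - t'\<^sup>2))"
    using sq unfolding c by simp
  then have "c\<^sup>2 = (4 * n - t\<^sup>2) * (4 * n' - t'\<^sup>2)" by (simp only: of_int_eq_iff)
  then have "even (c\<^sup>2) \<longleftrightarrow> even ((4 * n - t\<^sup>2) * (4 * n' - t'\<^sup>2))" by simp
  then have "even (t * t' + c)" by auto
  then obtain e where "t * t' + c = 2 * e" by (elim evenE)
  moreover have "2 * (2 * (x * x' + d * y * y')) = of_int (t * t' + c)"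
    by (simp flip: c t add: algebra_simps)
  ultimately have "2 * (x * x' + d * y * y') = of_int e" by simp
  then show ?thesis by simp
qed

text \<open>A monic integral equation of degree m expresses z^m through lower powers, so the span of
  the powers below m is stable under z. This makes \<open>norm_square_integral\<close> applicable to
  algebraic integers.\<close>

lemma algebraic_int_powers_span:
  fixes z :: complex
  assumes "algebraic_int z"
  obtains m where "1 \<in> int_span ((\<lambda>i. z ^ i) ` {..<m})"
    "\<And>y. y \<in> int_span ((\<lambda>i. z ^ i) ` {..<m}) \<Longrightarrow> z * y \<in> int_span ((\<lambda>i. z ^ i) ` {..<m})"
proof -
  obtain p where p: "lead_coeff p = 1" "\<And>i. coeff p i \<in> \<int>" "poly p z = 0"
    using assms by (auto simp: algebraic_int.simps)
  define m where "m = degree p"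
  let ?S = "(\<lambda>i. z ^ i) ` {..<m}"
  \<comment> \<open>Needed for 1 = z^0 to be among the generators; a monic constant has no
    root.\<close>
  have m0: "m > 0"
  proof (rule ccontr)
    assume "\<not> m > 0"
    then have "p = [:1:]" using p(1) unfolding m_def by (metis degree_eq_zeroE lead_coeff_pCons(2) neq0_conv)
    then show False using p(3) by simp
  qed
  have base: "z ^ i \<in> int_span ?S" if "i < m" for i
    using that by (intro int_span_base) auto
  have "0 = (\<Sum>i\<le>m. coeff p i * z ^ i)" using p(3) by (simp add: poly_altdef m_def)
  also have "\<dots> = (\<Sum>i<m. coeff p i * z ^ i) + z ^ m"
    using p(1) by (simp add: lessThan_Suc_atMost[symmetric] m_def)
  finally have "z ^ m = - (\<Sum>i<m. coeff p i * z ^ i)" by (simp add: eq_neg_iff_add_eq_0 add.commute)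
  also have "\<dots> \<in> int_span ?S"
  proof (intro int_span_neg int_span_sum)
    fix i assume i: "i \<in> {..<m}"
    obtain k where "coeff p i = of_int k" using p(2)[of i] by (elim Ints_cases)
    then have "coeff p i * z ^ i = of_int k *\<^sub>R z ^ i" by (simp add: scaleR_conv_of_real)
    then show "coeff p i * z ^ i \<in> int_span ?S" using base i by (simp add: int_span_scale)
  qed
  finally have top: "z ^ m \<in> int_span ?S" .
  have pow: "z ^ Suc i \<in> int_span ?S" if "i < m" for i
    using that base[of "Suc i"] top by (cases "Suc i = m") auto
  show ?thesis
  proof (rule that)
    show "1 \<in> int_span ?S" using base[OF m0] by simp
    show "z * y \<in> int_span ?S" if "y \<in> int_span ?S" for y
      using that
    proof (induction rule: int_span_induct)
      case base
      then show ?case by (simp add: int_span_zero)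
    next
      case (step c x y)
      then obtain i where i: "i < m" "x = z ^ i" by auto
      have "z * (of_int c *\<^sub>R x + y) = of_int c *\<^sub>R z ^ Suc i + z * y"
        by (simp add: i algebra_simps)
      then show ?case using step pow[OF i(1)] by (simp add: int_span_add int_span_scale)
    qed
  qed
qed

lemma complex_of_real_of_rat: "complex_of_real (of_rat r) = of_rat r"
  by (cases r) (simp add: of_rat_rat)

lemma imaginary_quadratic_field_cases:
  assumes "imaginary_quadratic_field K"
  obtains d :: nat where "\<And>z. z \<in> K \<longleftrightarrow> Re z \<in> \<rat> \<and> (\<exists>y\<in>\<rat>. Im z = y * sqrt d)"
proof -
  obtain d :: nat where K: "K = {of_rat x + of_rat y * (\<i> * of_real (sqrt d)) |x y. True}"
    using assms by (auto simp: imaginary_quadratic_field_def)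
  have "of_rat x + of_rat y * (\<i> * of_real (sqrt d)) = Complex (of_rat x) (of_rat y * sqrt d)" for x y
    by (simp add: complex_eq_iff flip: complex_of_real_of_rat)
  then have "z \<in> K \<longleftrightarrow> (\<exists>x y. Re z = of_rat x \<and> Im z = of_rat y * sqrt d)" for z
    by (simp add: K complex_eq_iff)
  then show ?thesis by (intro that[of d]) (auto simp: Rats_def)
qed

locale imag_quadratic =
  fixes K :: "complex set" and d :: nat
  assumes K_iff: "z \<in> K \<longleftrightarrow> Re z \<in> \<rat> \<and> (\<exists>y\<in>\<rat>. Im z = y * sqrt d)"
begin

lemma K_cases:
  assumes "z \<in> K"
  obtains x y where "x \<in> \<rat>" "y \<in> \<rat>" "z = Complex x (y * sqrt d)"
  using assms by (auto simp: K_iff complex_eq_iff)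

lemma K_I: "x \<in> \<rat> \<Longrightarrow> y \<in> \<rat> \<Longrightarrow> Complex x (y * sqrt d) \<in> K"
  by (auto simp: K_iff)

lemma Complex_diff_sqrt:
  "Complex x (y * sqrt d) - Complex x' (y' * sqrt d) = Complex (x - x') ((y - y') * sqrt d)"
  by (simp add: complex_eq_iff algebra_simps)

lemma Complex_mult_sqrt:
  fixes x y x' y' :: real
  shows "Complex x (y * sqrt d) * Complex x' (y' * sqrt d) =
    Complex (x * x' - d * y * y') ((x * y' + y * x') * sqrt d)"
  by (simp add: complex_eq_iff algebra_simps)

lemma Complex_norm_sqrt:
  fixes x y :: real
  shows "(cmod (Complex x (y * sqrt d)))\<^sup>2 = x\<^sup>2 + d * y\<^sup>2"
  by (simp add: cmod_power2 power_mult_distrib)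

lemma K_diff: "z \<in> K \<Longrightarrow> w \<in> K \<Longrightarrow> z - w \<in> K"
  by (elim K_cases) (auto simp: Complex_diff_sqrt intro!: K_I)

lemma K_mult: "z \<in> K \<Longrightarrow> w \<in> K \<Longrightarrow> z * w \<in> K"
  by (elim K_cases) (auto simp: Complex_mult_sqrt intro!: K_I)

lemma K_one: "1 \<in> K"
  by (auto simp: K_iff)

lemma K_power: "z \<in> K \<Longrightarrow> z ^ n \<in> K"
  by (induction n) (auto simp: K_one K_mult)

lemma Complex_inner_sqrt:
  fixes x y x' y' :: real
  shows "inner (Complex x (y * sqrt d)) (Complex x' (y' * sqrt d)) = x * x' + d * y * y'"
  by (simp add: inner_complex_def)

lemma K_inner: "z \<in> K \<Longrightarrow> w \<in> K \<Longrightarrow> inner z w \<in> \<rat>"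
  by (elim K_cases) (auto simp: Complex_inner_sqrt)

text \<open>Both z and 1 + z preserve the lattice Z[z], so their squared norms are integers, and
  their difference yields the trace. Conversely z is a root of X^2 - t X + n with t its trace and n
  its norm.\<close>

lemma ring_of_integers_iff:
  "z \<in> ring_of_integers K \<longleftrightarrow> z \<in> K \<and> (cmod z)\<^sup>2 \<in> \<int> \<and> 2 * Re z \<in> \<int>"
proof
  assume "z \<in> ring_of_integers K"
  then have z: "z \<in> K" "algebraic_int z" by (auto simp: ring_of_integers_def)
  obtain m where m: "1 \<in> int_span ((\<lambda>i. z ^ i) ` {..<m})"
    "\<And>y. y \<in> int_span ((\<lambda>i. z ^ i) ` {..<m}) \<Longrightarrow> z * y \<in> int_span ((\<lambda>i. z ^ i) ` {..<m})"
    using algebraic_int_powers_span[OF z(2)] by blast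
  let ?S = "(\<lambda>i. z ^ i) ` {..<m}"
  have int: "(norm x)\<^sup>2 \<in> \<int>" if "\<And>y. y \<in> int_span ?S \<Longrightarrow> x * y \<in> int_span ?S" for x
    using that m(1) by (intro norm_square_integral[of ?S]) (auto intro!: K_inner K_power z)
  have nz: "(cmod z)\<^sup>2 \<in> \<int>" using m(2) by (rule int)
  have "(cmod (1 + z))\<^sup>2 \<in> \<int>"
    using m(2) by (intro int) (simp add: distrib_right int_span_add)
  then have "(cmod (1 + z))\<^sup>2 - (cmod z)\<^sup>2 - 1 \<in> \<int>" using nz by simp
  moreover have "(cmod (1 + z))\<^sup>2 - (cmod z)\<^sup>2 - 1 = 2 * Re z"
    unfolding cmod_power2 by (simp add: power2_eq_square algebra_simps)
  ultimately show "z \<in> K \<and> (cmod z)\<^sup>2 \<in> \<int> \<and> 2 * Re z \<in> \<int>" using z nz by simp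
next
  assume z: "z \<in> K \<and> (cmod z)\<^sup>2 \<in> \<int> \<and> 2 * Re z \<in> \<int>"
  then obtain n t where n: "(cmod z)\<^sup>2 = of_int n" and t: "2 * Re z = of_int t" by (metis Ints_cases)
  have "z * z - of_int t * z + of_int n = z * z - of_real (2 * Re z) * z + of_real ((cmod z)\<^sup>2)"
    by (simp only: n t of_real_of_int_eq)
  also have "\<dots> = 0"
    unfolding cmod_power2 by (simp add: complex_eq_iff power2_eq_square algebra_simps)
  finally have "poly [:of_int n, - of_int t, 1:] z = 0" by (simp add: algebra_simps)
  then have "algebraic_int z"
    by (intro algebraic_int.intros[of "[:of_int n, - of_int t, 1:]"])
      (auto simp: coeff_pCons split: nat.splits)
  then show "z \<in> ring_of_integers K" using z by (simp add: ring_of_integers_def)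
qed

text \<open>This polarised norm is what ring closure requires: it is the cross term of |z - w|^2,
  and tr(z w) = tr(z) tr(w) - tr(z \<open>cnj w\<close>).\<close>

lemma trace_mult_cnj:
  assumes "z \<in> ring_of_integers K" "w \<in> ring_of_integers K"
  shows "2 * Re (z * cnj w) \<in> \<int>"
proof -
  have z: "z \<in> K" "(cmod z)\<^sup>2 \<in> \<int>" "2 * Re z \<in> \<int>" and w: "w \<in> K" "(cmod w)\<^sup>2 \<in> \<int>" "2 * Re w \<in> \<int>"
    using assms by (auto simp: ring_of_integers_iff)
  obtain x y where xy: "x \<in> \<rat>" "y \<in> \<rat>" "z = Complex x (y * sqrt d)" using z(1) by (rule K_cases)
  obtain x' y' where xy': "x' \<in> \<rat>" "y' \<in> \<rat>" "w = Complex x' (y' * sqrt d)" using w(1) by (rule K_cases)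
  have "2 * (x * x' + d * y * y') \<in> \<int>"
    using z(2,3) w(2,3) xy xy' by (intro quadratic_trace_mult_cnj) (simp_all add: Complex_norm_sqrt)
  then show ?thesis by (simp add: xy xy' algebra_simps)
qed

lemma ring_of_integers_one: "1 \<in> ring_of_integers K"
  by (simp add: ring_of_integers_def K_one)

lemma ring_of_integers_diff:
  assumes z: "z \<in> ring_of_integers K" and w: "w \<in> ring_of_integers K"
  shows "z - w \<in> ring_of_integers K"
proof -
  have "(cmod (z - w))\<^sup>2 = (cmod z)\<^sup>2 + (cmod w)\<^sup>2 - 2 * Re (z * cnj w)"
    unfolding cmod_power2 by (simp add: power2_eq_square algebra_simps)
  then show ?thesis
    using z w trace_mult_cnj[OF z w] by (simp add: ring_of_integers_iff K_diff right_diff_distrib)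
qed

lemma ring_of_integers_mult:
  assumes z: "z \<in> ring_of_integers K" and w: "w \<in> ring_of_integers K"
  shows "z * w \<in> ring_of_integers K"
proof -
  have "2 * Re (z * w) = (2 * Re z) * (2 * Re w) - 2 * Re (z * cnj w)"
    by (simp add: algebra_simps)
  then have "2 * Re (z * w) \<in> \<int>"
    using z w trace_mult_cnj[OF z w] by (simp only: ring_of_integers_iff Ints_diff Ints_mult)
  then show ?thesis
    using z w by (simp add: ring_of_integers_iff K_mult norm_mult power_mult_distrib)
qed

end

lemma elementary_setting_complex:
  assumes "imaginary_quadratic_field K"
  defines "R \<equiv> ring_of_integers K"
  shows "elementary_setting {M \<in> mat2_over R. det M = 1} R R"
proof -
  obtain d :: nat where "\<And>z. z \<in> K \<longleftrightarrow> Re z \<in> \<rat> \<and> (\<exists>y\<in>\<rat>. Im z = y * sqrt d)"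
    using imaginary_quadratic_field_cases[OF assms(1)] by blast
  then interpret imag_quadratic K d by unfold_locales
  note one = ring_of_integers_one[folded R_def] and diff = ring_of_integers_diff[folded R_def]
    and mult = ring_of_integers_mult[folded R_def]
  have zero: "0 \<in> R" using diff[OF one one] by simp
  have neg: "- x \<in> R" if "x \<in> R" for x using diff[OF zero that] by simp
  have add: "x + y \<in> R" if "x \<in> R" "y \<in> R" for x y using diff[OF that(1) neg[OF that(2)]] by simp
  have of_nat: "of_nat n \<in> R" for n using of_int_in_ring[OF one diff, of "int n"] by simp
  let ?X = "{M \<in> mat2_over R. det M = 1}"
  show ?thesis
  proof (rule elementary_setting_full)
    show "group (matrix_group ?X)"
    proof (rule group_matrix_groupI)
      show "mat 1 \<in> ?X" by (simp add: one zero mat_1_mat2 det_2)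
      show "M ** N \<in> ?X" if "M \<in> ?X" "N \<in> ?X" for M N
        using that by (auto simp: mat2_over_def det_mul) (auto simp: matrix_matrix_mult_def sum_2 intro!: add mult)
      show "\<exists>N\<in>?X. N ** M = mat 1" if "M \<in> ?X" for M
      proof -
        obtain a b c d where M: "M = mat2 a b c d" by (rule mat2_cases)
        show ?thesis using that neg unfolding M
          by (intro bexI[of _ "mat2 d (- b) (- c) a"]) (auto simp: mat2_mult mat_1_mat2 det_2 algebra_simps)
      qed
    qed
    show "?X \<subseteq> mat2_over R" by auto
    show "(norm x)\<^sup>2 \<in> \<int>" if "x \<in> R" for x using that by (simp add: R_def ring_of_integers_iff)
    show "inverse x \<in> span R" if "x \<in> span R" for x using one that by (rule span_inverse_complex)
    show "W_mat \<alpha> \<in> ?X" if "\<alpha> \<in> R" for \<alpha>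
      using that one zero neg by (simp add: W_mat_mat2 det_2)
    show "parab (s /\<^sub>R of_nat n) ((of_nat n)\<^sup>2) \<in> ?X" if "s \<in> R" "n > 0" for s n
      unfolding parab_integral_entries[OF that(2)]
      using that(1) by (auto simp: det_2 power2_eq_square algebra_simps intro!: add diff mult neg one of_nat)
  qed (fact one diff mult)+
qed

section \<open>Infinite index\<close>

theorem theorem7p1:
  shows
    "(\<forall>K. imaginary_quadratic_field K \<longrightarrow>
        (let R = ring_of_integers K; G = SL2_complex R in
          (\<exists>u \<in> trace_zero cnj R. u \<noteq> 0 \<and> (\<exists>B \<in> open_balls R. orbit_avoids_ball G R u B)) \<longrightarrow>
          infinite_index_subgroup (elementary_subgroup G) G)) \<and>
     (\<forall>a b R. a < 0 \<and> b < 0 \<and> maximal_dag_order (quaternion_algebra a b) R \<longrightarrow>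
        (let P = dag_fixed R; G = SL2_dag R in
          (\<exists>u \<in> trace_zero qcnj P. u \<noteq> 0 \<and> (\<exists>B \<in> open_balls P. orbit_avoids_ball G P u B)) \<longrightarrow>
          infinite_index_subgroup (elementary_subgroup G) G)) \<and>
     (\<forall>a b R. a < 0 \<and> b < 0 \<and> maximal_order (quaternion_algebra a b) R \<longrightarrow>
        (let G = SL2_quat R in
          (\<exists>u \<in> trace_zero qcnj R. u \<noteq> 0 \<and> (\<exists>B \<in> open_balls R. orbit_avoids_ball G R u B)) \<longrightarrow>
          infinite_index_subgroup (elementary_subgroup G) G))"
proof (intro conjI allI impI)
  fix K assume K: "imaginary_quadratic_field K"
  show "let R = ring_of_integers K; G = SL2_complex R in
    (\<exists>u \<in> trace_zero cnj R. u \<noteq> 0 \<and> (\<exists>B \<in> open_balls R. orbit_avoids_ball G R u B)) \<longrightarrow>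
    infinite_index_subgroup (elementary_subgroup G) G"
    unfolding Let_def SL2_complex_def trace_zero_def
    using elementary_setting.infinite_index[OF elementary_setting_complex[OF K]] by blast
next
  fix a b R assume "a < 0 \<and> b < 0 \<and> maximal_dag_order (quaternion_algebra a b) R"
  then have S: "elementary_setting {M \<in> mat2_over R. dag_hat M ** M = mat 1 \<and> M ** dag_hat M = mat 1}
      R (dag_fixed R)"
    using elementary_setting_dag by blast
  show "let P = dag_fixed R; G = SL2_dag R in
    (\<exists>u \<in> trace_zero qcnj P. u \<noteq> 0 \<and> (\<exists>B \<in> open_balls P. orbit_avoids_ball G P u B)) \<longrightarrow>
    infinite_index_subgroup (elementary_subgroup G) G"
    unfolding Let_def SL2_dag_def trace_zero_def
    using elementary_setting.infinite_index[OF S] by blast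
next
  fix a b R assume "a < 0 \<and> b < 0 \<and> maximal_order (quaternion_algebra a b) R"
  then have S: "elementary_setting {M \<in> mat2_over R. det (block_matrix M) = 1} R R"
    using elementary_setting_quat by blast
  show "let G = SL2_quat R in
    (\<exists>u \<in> trace_zero qcnj R. u \<noteq> 0 \<and> (\<exists>B \<in> open_balls R. orbit_avoids_ball G R u B)) \<longrightarrow>
    infinite_index_subgroup (elementary_subgroup G) G"
    unfolding Let_def SL2_quat_def trace_zero_def
    using elementary_setting.infinite_index[OF S] by blast
qed

end
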